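(* There is an algorithm which, given a mapping $\varphi:V\to[\Delta]^d$ on an $n$-element set $V$, runs in time $n\cdot\mathrm{poly}(dL\log n)$, where $L=1+\log\Delta$, and outputs $I=(I_1,I_2,\dots,I_n)$ with the following property. Whenever $G=(V,E,w)$ is an undirected graph with $|V|=n$, $|E|=m$ and $\alpha$ is such that $$\forall u,v\in V,\quad \mathrm{dist}_G(u,v)\le\|\varphi(u)-\varphi(v)\|_1\le\alpha\cdot\mathrm{dist}_G(u,v),$$ the output $I$ is a compressed representation of a matrix $P$ with full column rank and $\kappa(PAW^{-1})\le O(\alpha Ld)$, where $A\in\mathbb{R}^{n\times m}$ is the vertex-edge incidence matrix of $G$ and $W\in\mathbb{R}^{m\times m}$ is its diagonal weight matrix. Furthermore, for every $i\in\{1,\dots,n\}$, the size of $I_i$ is at most $(d+1)L$.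
   Context: $[\Delta]=\{1,\dots,\Delta\}$, $\Delta$ is a power of $2$, $\log$ is base 2. The graph $G$ is connected with positive integer edge weights; $\mathrm{dist}_G$ is the shortest path distance. Incidence and weight matrices: identify $V$ with $\{1,\dots,n\}$ and order the edges; $A_{i,j}=1$ if the $j$-th edge is $\{i,v\}$ with $i<v$, $A_{i,j}=-1$ if it is $\{i,v\}$ with $i>v$, and $A_{i,j}=0$ otherwise; $W$ is diagonal with $j$-th diagonal entry the weight of the $j$-th edge. Non-linear condition number: for $B\in\mathbb{R}^{r\times m}$, let $\|B\|_{1\to1}=\sup_{x\ne0}\|Bx\|_1/\|x\|_1$ and $$\kappa(B)=\|B\|_{1\to1}\cdot\max_{g\in\{Bx:\,x\in\mathbb{R}^m\}\setminus\{0\}}\ \min_{x:\,Bx=g}\frac{\|x\|_1}{\|g\|_1}.$$ Compressed representation of a vector $x\in\mathbb{R}^r$: a set $J=\{([a_1,b_1],c_1),\dots,([a_s,b_s],c_s)\}$ with $c_i\in\mathbb{R}$, pairwise disjoint integer intervals $[a_i,b_i]\subseteq[1,r]$, such that $x_j=c_i$ for $j\in[a_i,b_i]$ and $x_j=0$ for $j$ outside all the intervals; its size is $|J|=s$. A compressed representation of a matrix $P\in\mathbb{R}^{r\times n}$ is a tuple $(I_1,\dots,I_n)$ where $I_i$ is a compressed representation of the $i$-th column of $P$. *)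

theory Defs
  imports
    "HOL-Library.Extended_Nonnegative_Real"
    "HOL-Library.Log_Nat"
    "HOL-Computational_Algebra.Polynomial"
    "Jordan_Normal_Form.DL_Rank"
    "Jordan_Normal_Form.Gauss_Jordan_Elimination"
begin

section \<open>Machine model\<close>

text \<open>
  Algorithms are programs of a deterministic random access machine, in structured form: a program
  has finitely many integer registers and finitely many integer arrays, the latter with computed
  (indirect) addresses. Several named arrays are the same as one memory in which they are
  interleaved. Running time is measured by the logarithmic cost criterion: integers are unbounded,
  but every access and every operation is charged by the bit lengths of the numbers and
  addresses involved. Multiplication and division are charged by the product of the bit
  lengths, as for the schoolbook method.
\<close>

datatype aexp =
    Num int
  | Reg string
  | Arr string aexp
  | Plus aexp aexp
  | Minus aexp aexp
  | Times aexp aexp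
  | Divide aexp aexp
  | Modulo aexp aexp

datatype bexp =
    Less aexp aexp
  | Neg bexp
  | Conj bexp bexp

datatype com =
    Skip
  | Assign string aexp
  | Store string aexp aexp
  | Seq com com
  | Cond bexp com com
  | While bexp com

record state =
  regs :: "string \<Rightarrow> int"
  arrs :: "string \<Rightarrow> int \<Rightarrow> int"

text \<open>Bit length including a sign bit, so that it is at least 1.\<close>

definition len :: "int \<Rightarrow> nat" where
  "len z = 1 + nat (bitlen \<bar>z\<bar>)"

primrec aval :: "aexp \<Rightarrow> state \<Rightarrow> int" where
  "aval (Num k) s = k"
| "aval (Reg x) s = regs s x"
| "aval (Arr a e) s = arrs s a (aval e s)"
| "aval (Plus e f) s = aval e s + aval f s"
| "aval (Minus e f) s = aval e s - aval f s"
| "aval (Times e f) s = aval e s * aval f s"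
| "aval (Divide e f) s = aval e s div aval f s"
| "aval (Modulo e f) s = aval e s mod aval f s"

primrec acost :: "aexp \<Rightarrow> state \<Rightarrow> nat" where
  "acost (Num k) s = len k"
| "acost (Reg x) s = len (regs s x)"
| "acost (Arr a e) s = acost e s + len (aval e s) + len (arrs s a (aval e s))"
| "acost (Plus e f) s = acost e s + acost f s + len (aval e s) + len (aval f s)"
| "acost (Minus e f) s = acost e s + acost f s + len (aval e s) + len (aval f s)"
| "acost (Times e f) s = acost e s + acost f s + len (aval e s) * len (aval f s)"
| "acost (Divide e f) s = acost e s + acost f s + len (aval e s) * len (aval f s)"
| "acost (Modulo e f) s = acost e s + acost f s + len (aval e s) * len (aval f s)"

primrec bval :: "bexp \<Rightarrow> state \<Rightarrow> bool" where
  "bval (Less e f) s \<longleftrightarrow> aval e s < aval f s"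
| "bval (Neg b) s \<longleftrightarrow> \<not> bval b s"
| "bval (Conj b c) s \<longleftrightarrow> bval b s \<and> bval c s"

primrec bcost :: "bexp \<Rightarrow> state \<Rightarrow> nat" where
  "bcost (Less e f) s = acost e s + acost f s + len (aval e s) + len (aval f s)"
| "bcost (Neg b) s = bcost b s + 1"
| "bcost (Conj b c) s = bcost b s + bcost c s + 1"

text \<open>\<open>exec c s t s'\<close>: started in state \<open>s\<close>, the program \<open>c\<close> halts in state \<open>s'\<close> after time \<open>t\<close>.\<close>

inductive exec :: "com \<Rightarrow> state \<Rightarrow> nat \<Rightarrow> state \<Rightarrow> bool" where
  Skip: "exec Skip s 1 s"
| Assign: "exec (Assign x e) s (acost e s + len (aval e s))
     (s\<lparr>regs := (regs s)(x := aval e s)\<rparr>)"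
| Store: "exec (Store a i e) s (acost i s + acost e s + len (aval i s) + len (aval e s))
     (s\<lparr>arrs := (arrs s)(a := (arrs s a)(aval i s := aval e s))\<rparr>)"
| Seq: "exec c s t s' \<Longrightarrow> exec c' s' t' s'' \<Longrightarrow> exec (Seq c c') s (t + t') s''"
| CondTrue: "bval b s \<Longrightarrow> exec c s t s' \<Longrightarrow> exec (Cond b c c') s (bcost b s + 1 + t) s'"
| CondFalse: "\<not> bval b s \<Longrightarrow> exec c' s t s' \<Longrightarrow> exec (Cond b c c') s (bcost b s + 1 + t) s'"
| WhileFalse: "\<not> bval b s \<Longrightarrow> exec (While b c) s (bcost b s + 1) s"
| WhileTrue: "bval b s \<Longrightarrow> exec c s t s' \<Longrightarrow> exec (While b c) s' t' s'' \<Longrightarrow>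
     exec (While b c) s (bcost b s + 1 + t + t') s''"

inductive_cases SkipE: "exec Skip s t s'"
inductive_cases AssignE: "exec (Assign x e) s t s'"
inductive_cases StoreE: "exec (Store a i e) s t s'"
inductive_cases SeqE: "exec (Seq c c') s t s'"
inductive_cases CondE: "exec (Cond b c c') s t s'"
inductive_cases WhileE: "exec (While b c) s t s'"

lemma exec_deterministic:
  "exec c s t s' \<Longrightarrow> exec c s u s'' \<Longrightarrow> u = t \<and> s'' = s'"
proof (induction arbitrary: u s'' rule: exec.induct)
  case (Skip s)
  then show ?case by (auto elim: SkipE)
next
  case (Assign x e s)
  then show ?case by (auto elim: AssignE)
next
  case (Store a i e s)
  then show ?case by (auto elim: StoreE)
next
  case (Seq c s t s' c' t' s2)
  from Seq.prems obtain t1 t2 s1 where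
    "u = t1 + t2" "exec c s t1 s1" "exec c' s1 t2 s''"
    by (rule SeqE)
  with Seq.IH(1)[of t1 s1] Seq.IH(2)[of t2 s''] show ?case by simp
next
  case (CondTrue b s c t s' c')
  from CondTrue.prems CondTrue.hyps(1) obtain t1 where
    "u = bcost b s + 1 + t1" "exec c s t1 s''"
    by (auto elim: CondE)
  with CondTrue.IH[of t1 s''] show ?case by simp
next
  case (CondFalse b s c' t s' c)
  from CondFalse.prems CondFalse.hyps(1) obtain t1 where
    "u = bcost b s + 1 + t1" "exec c' s t1 s''"
    by (auto elim: CondE)
  with CondFalse.IH[of t1 s''] show ?case by simp
next
  case (WhileFalse b s c)
  from WhileFalse.prems WhileFalse.hyps show ?case
    by (auto elim: WhileE)
next
  case (WhileTrue b s c t s' t' s2)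
  obtain t1 t2 s1 where
    "u = bcost b s + 1 + t1 + t2" "exec c s t1 s1" "exec (While b c) s1 t2 s''"
    by (rule WhileE[OF WhileTrue.prems]) (use WhileTrue.hyps(1) in auto)
  with WhileTrue.IH(1)[of t1 s1] WhileTrue.IH(2)[of t2 s''] show ?case by simp
qed

section \<open>Input and output of the algorithm\<close>

text \<open>
  Vertices, coordinates, edges and matrix rows are numbered from 0, as in the matrix library.
  A map \<open>\<phi>\<close> from \<open>{0..<n}\<close> to \<open>[\<Delta>]\<^sup>d\<close> is given by the numbers \<open>\<phi> v k\<close> for \<open>v < n\<close> and \<open>k < d\<close>, and
  is stored in row-major order; all other registers and array cells are 0.
\<close>

definition input_state :: "nat \<Rightarrow> nat \<Rightarrow> nat \<Rightarrow> (nat \<Rightarrow> nat \<Rightarrow> nat) \<Rightarrow> state" where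
  "input_state n d \<Delta> \<phi> = \<lparr>
     regs = (\<lambda>_. 0)(''n'' := int n, ''d'' := int d, ''Delta'' := int \<Delta>),
     arrs = (\<lambda>_ _. 0)(''phi'' := (\<lambda>z. if 0 \<le> z \<and> z < int (n * d)
                                        then int (\<phi> (nat z div d) (nat z mod d)) else 0))\<rparr>"

type_synonym comp_vec = "((int \<times> int) \<times> real) set"

text \<open>
  The columns of the output are stored one after the other: array \<open>size\<close> holds their lengths, and
  an entry \<open>([a, b], c)\<close> is stored as \<open>a\<close>, \<open>b\<close> and a numerator and denominator of \<open>c\<close>, at
  the same position of four arrays.
\<close>

definition out_size :: "state \<Rightarrow> nat \<Rightarrow> nat" where
  "out_size s i = nat (arrs s ''size'' (int i))"

definition out_col :: "state \<Rightarrow> nat \<Rightarrow> comp_vec" where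
  "out_col s i =
     (\<lambda>p. ((arrs s ''lo'' (int p), arrs s ''hi'' (int p)),
           real_of_int (arrs s ''num'' (int p)) / real_of_int (arrs s ''den'' (int p))))
     ` {(\<Sum>j<i. out_size s j) ..< (\<Sum>j<Suc i. out_size s j)}"

section \<open>Compressed representations\<close>

definition compressed_vec :: "comp_vec \<Rightarrow> real vec \<Rightarrow> bool" where
  "compressed_vec J x \<longleftrightarrow> finite J \<and>
     (\<forall>((a, b), c) \<in> J. 0 \<le> a \<and> a \<le> b \<and> b < int (dim_vec x)) \<and>
     (\<forall>((a, b), c) \<in> J. \<forall>((a', b'), c') \<in> J.
        ((a, b), c) \<noteq> ((a', b'), c') \<longrightarrow> {a..b} \<inter> {a'..b'} = {}) \<and>
     (\<forall>((a, b), c) \<in> J. \<forall>j < dim_vec x. int j \<in> {a..b} \<longrightarrow> x $ j = c) \<and>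
     (\<forall>j < dim_vec x. (\<forall>((a, b), c) \<in> J. int j \<notin> {a..b}) \<longrightarrow> x $ j = 0)"

definition compressed_mat :: "(nat \<Rightarrow> comp_vec) \<Rightarrow> real mat \<Rightarrow> bool" where
  "compressed_mat I P \<longleftrightarrow> (\<forall>i < dim_col P. compressed_vec (I i) (col P i))"

section \<open>Weighted graphs\<close>

definition walk :: "nat \<Rightarrow> nat set set \<Rightarrow> nat \<Rightarrow> nat list \<Rightarrow> nat \<Rightarrow> bool" where
  "walk n E u p v \<longleftrightarrow> p \<noteq> [] \<and> hd p = u \<and> last p = v \<and> set p \<subseteq> {..<n} \<and>
     successively (\<lambda>x y. {x, y} \<in> E) p"

definition walk_weight :: "(nat set \<Rightarrow> nat) \<Rightarrow> nat list \<Rightarrow> nat" where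
  "walk_weight w p = (\<Sum>i<length p - 1. w {p ! i, p ! Suc i})"

definition connected_weighted_graph ::
    "nat \<Rightarrow> nat set set \<Rightarrow> (nat set \<Rightarrow> nat) \<Rightarrow> bool" where
  "connected_weighted_graph n E w \<longleftrightarrow> n > 0 \<and>
     (\<forall>e\<in>E. e \<subseteq> {..<n} \<and> card e = 2) \<and> (\<forall>e\<in>E. w e > 0) \<and>
     (\<forall>u<n. \<forall>v<n. \<exists>p. walk n E u p v)"

definition graph_dist ::
    "nat \<Rightarrow> nat set set \<Rightarrow> (nat set \<Rightarrow> nat) \<Rightarrow> nat \<Rightarrow> nat \<Rightarrow> nat" where
  "graph_dist n E w u v = (INF p \<in> {p. walk n E u p v}. walk_weight w p)"

text \<open>In the next two definitions \<open>es\<close> is an enumeration of the edges without repetition.\<close>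

definition incidence_mat :: "nat \<Rightarrow> nat set list \<Rightarrow> real mat" where
  "incidence_mat n es = mat n (length es) (\<lambda>(i, j).
     if \<exists>v. es ! j = {i, v} \<and> i < v then 1
     else if \<exists>v. es ! j = {i, v} \<and> i > v then -1
     else 0)"

definition weight_mat :: "nat set list \<Rightarrow> (nat set \<Rightarrow> nat) \<Rightarrow> real mat" where
  "weight_mat es w = mat_diag (length es) (\<lambda>j. real (w (es ! j)))"

definition coord_dist :: "nat \<Rightarrow> (nat \<Rightarrow> nat) \<Rightarrow> (nat \<Rightarrow> nat) \<Rightarrow> real" where
  "coord_dist d x y = (\<Sum>k<d. \<bar>real (x k) - real (y k)\<bar>)"

section \<open>Non-linear condition number\<close>

definition norm1 :: "real vec \<Rightarrow> real" where
  "norm1 x = (\<Sum>i<dim_vec x. \<bar>x $ i\<bar>)"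

text \<open>
  Suprema and infima are taken in \<^typ>\<open>ennreal\<close>, where they always exist; in particular the supremum
  over the empty set, which arises for \<open>B = 0\<close> or for a matrix without columns, is 0.
\<close>

definition opnorm1 :: "real mat \<Rightarrow> ennreal" where
  "opnorm1 B = (SUP x \<in> carrier_vec (dim_col B) - {0\<^sub>v (dim_col B)}.
                  ennreal (norm1 (B *\<^sub>v x) / norm1 x))"

definition kappa :: "real mat \<Rightarrow> ennreal" where
  "kappa B = opnorm1 B *
     (SUP g \<in> (\<lambda>x. B *\<^sub>v x) ` carrier_vec (dim_col B) - {0\<^sub>v (dim_row B)}.
        INF x \<in> {x \<in> carrier_vec (dim_col B). B *\<^sub>v x = g}.
          ennreal (norm1 x / norm1 g))"

definition full_column_rank :: "real mat \<Rightarrow> bool" where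
  "full_column_rank P \<longleftrightarrow> vec_space.rank (dim_row P) P = dim_col P"

end

theory Submission
  imports Defs
begin

text \<open>
  Shift the grid of side \<open>2\<^sup>t\<close> along the diagonal by each \<open>r < 2\<^sup>t\<close>, for \<open>t \<le> l\<close>; the matrix sums a
  demand over every cell of every shifted grid. As \<open>r\<close> runs through \<open>[0, 2\<^sup>t)\<close>, the cell of a point
  changes at most \<open>d\<close> times, so with rows of equal cell and consecutive shift adjacent, a column is the
  indicator of at most \<open>(d + 1) L\<close> intervals.

  Two points at distance \<open>D\<close> are separated by at most \<open>D\<close> shifts per level, by Hermite's identity
  \<open>(\<Sum>r<T. (x + r) div T) = x\<close>, which bounds the operator norm by \<open>2 \<alpha> L\<close>. Conversely, for a fixed \<open>r < 2\<^sup>l\<close> the cells form a hierarchy;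
  a demand routed bottom-up through cell representatives costs at most \<open>d 2\<^sup>t\<^sup>+\<^sup>1\<close> per unit leaving a cell
  of level \<open>t\<close>, and averaging over \<open>r\<close> bounds the best cost by \<open>2 d\<close> times the norm of the image.
\<close>

text \<open>The matrix is fixed before any graph is seen, so it can use only the geometry of the
  points. A graph enters through the two distance bounds alone: the upper one is applied to single
  edges, the lower one to shortest paths. Shifting every coordinate by the same \<open>r\<close>
  keeps the offsets one-dimensional; this arranges a column in few intervals although the number of
  rows is exponential in \<open>d\<close> and \<open>l\<close>.

  Entries 0 and 1 suffice because level \<open>t\<close> occurs with \<open>2 ^ t\<close> shifts:
  the multiplicity of a level matches the side of its cells, which is also the price of moving
  demand out of them. Routing therefore costs no factor \<open>L\<close>; that factor comes from the
  operator norm, where every level may contribute the full distance. One factor 2 stems from the two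
  cells that an edge connects, another from the side of the parent cell, and together they give the
  constant 4.\<close>

section \<open>Shifted grids\<close>

text \<open>A row is numbered by the base \<open>B\<close> digits \<open>T\<close>, cell coordinates, shift. The shift comes last, so that
  the rows of one cell under consecutive shifts are consecutive; the numbering has gaps, which only adds zero
  rows and spares the algorithm from sorting the cells.\<close>

fun cell_code :: "nat \<Rightarrow> nat \<Rightarrow> (nat \<Rightarrow> nat) \<Rightarrow> nat \<Rightarrow> nat \<Rightarrow> nat" where
  "cell_code B T x r 0 = T"
| "cell_code B T x r (Suc k) = cell_code B T x r k * B + (x k + r) div T"

definition row_index :: "nat \<Rightarrow> nat \<Rightarrow> nat \<Rightarrow> (nat \<Rightarrow> nat) \<Rightarrow> nat \<Rightarrow> nat" where
  "row_index B d T x r = cell_code B T x r d * B + r"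

lemma digit_eq_iff:
  fixes a b c e B :: nat
  assumes "c < B" "e < B"
  shows "a * B + c = b * B + e \<longleftrightarrow> a = b \<and> c = e"
proof
  assume h: "a * B + c = b * B + e"
  have "(a * B + c) div B = a" "(b * B + e) div B = b"
    using assms by auto
  with h have "a = b" by simp
  with h show "a = b \<and> c = e" by simp
qed auto

lemma horner_less:
  fixes a c B :: nat
  assumes "a < B ^ k" "c < B"
  shows "a * B + c < B ^ Suc k"
proof -
  have "a * B + c < (a + 1) * B" using assms(2) by simp
  also have "\<dots> \<le> B ^ k * B" using assms(1) by (intro mult_right_mono) auto
  finally show ?thesis by (simp add: mult.commute)
qed

lemma cell_code_eq_iff:
  assumes "\<And>i. i < k \<Longrightarrow> (x i + r) div T < B" "\<And>i. i < k \<Longrightarrow> (x' i + r') div T' < B"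
  shows "cell_code B T x r k = cell_code B T' x' r' k \<longleftrightarrow>
    T = T' \<and> (\<forall>i<k. (x i + r) div T = (x' i + r') div T')"
  using assms
proof (induction k)
  case (Suc k)
  then show ?case
    by (auto simp: digit_eq_iff less_Suc_eq)
qed simp

lemma cell_code_less:
  assumes "T < B" "\<And>i. i < k \<Longrightarrow> (x i + r) div T < B"
  shows "cell_code B T x r k < B ^ Suc k"
  using assms
proof (induction k)
  case (Suc k)
  then show ?case
    using horner_less[of "cell_code B T x r k" B "Suc k" "(x k + r) div T"] by simp
qed simp

lemma row_index_less:
  assumes "T < B" "r < B" "\<And>i. i < d \<Longrightarrow> (x i + r) div T < B"
  shows "row_index B d T x r < B ^ (d + 2)"
  using horner_less[OF cell_code_less[OF assms(1,3)] assms(2)]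
  by (simp add: row_index_def)

text \<open>The level is the leading digit and the shift the last, so a row determines level, shift
  and cell. Different levels and shifts never share a row, and the norm of an image splits over
  them.\<close>

lemma row_index_eq_iff:
  assumes "r < B" "r' < B"
    "\<And>i. i < d \<Longrightarrow> (x i + r) div T < B" "\<And>i. i < d \<Longrightarrow> (x' i + r') div T' < B"
  shows "row_index B d T x r = row_index B d T' x' r' \<longleftrightarrow>
    r = r' \<and> T = T' \<and> (\<forall>i<d. (x i + r) div T = (x' i + r) div T)"
  using assms by (auto simp: row_index_def digit_eq_iff cell_code_eq_iff)

section \<open>Runs of consecutive shifts with constant cell\<close>

text \<open>The shifts at which the cell of \<open>x\<close> changes are the \<open>r\<close> with \<open>T\<close> dividing \<open>x j + r\<close>; the shift 0,
  represented by the index \<open>j = d\<close>, starts the first run.\<close>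

definition run_start :: "nat \<Rightarrow> nat \<Rightarrow> (nat \<Rightarrow> nat) \<Rightarrow> nat \<Rightarrow> nat" where
  "run_start d T x j = (if j < d then (T - x j mod T) mod T else 0)"

text \<open>Counts the shifts from \<open>s\<close> on, inside \<open>[0, T)\<close>, before one of
  the first \<open>k\<close> coordinates crosses a cell boundary. The recursion is the running
  minimum that the inner loop of the program keeps in register \<open>gap\<close>.\<close>

fun run_length :: "nat \<Rightarrow> (nat \<Rightarrow> nat) \<Rightarrow> nat \<Rightarrow> nat \<Rightarrow> nat" where
  "run_length T x s 0 = T - s"
| "run_length T x s (Suc k) = min (run_length T x s k) (T - (x k + s) mod T)"

lemma less_run_length_iff:
  "q < run_length T x s k \<longleftrightarrow> q < T - s \<and> (\<forall>i<k. q < T - (x i + s) mod T)"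
  by (induction k) (auto simp: less_Suc_eq)

lemma run_start_less: "T > 0 \<Longrightarrow> run_start d T x j < T"
  by (simp add: run_start_def)

lemma run_length_pos: "s < T \<Longrightarrow> run_length T x s k > 0"
  by (simp add: less_run_length_iff)

lemma run_length_le: "run_length T x s k \<le> T - s"
  by (induction k) auto

lemma div_eq_of_less_mod_gap:
  fixes y q T :: nat
  assumes "q < T - y mod T"
  shows "(y + q) div T = y div T"
proof -
  have "y mod T + q < T" "T > 0" using assms by auto
  moreover have "y + q = y div T * T + (y mod T + q)"
    by (simp flip: add.assoc)
  ultimately show ?thesis
    by (metis add.right_neutral div_less div_mult_self3 less_numeral_extra(3))
qed

lemma cell_code_cong:
  assumes "\<And>i. i < k \<Longrightarrow> (x i + r) div T = (x' i + r') div T"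
  shows "cell_code B T x r k = cell_code B T x' r' k"
  using assms by (induction k) auto

text \<open>Within a run the cell digits are frozen and only the last digit grows, which turns a run
  of shifts into an interval of rows.\<close>

lemma row_index_run:
  assumes "q < run_length T x s d"
  shows "row_index B d T x (s + q) = row_index B d T x s + q"
proof -
  have "cell_code B T x (s + q) d = cell_code B T x s d"
  proof (rule cell_code_cong)
    fix i assume "i < d"
    then have "q < T - (x i + s) mod T" using assms by (simp add: less_run_length_iff)
    then show "(x i + (s + q)) div T = (x i + s) div T"
      using div_eq_of_less_mod_gap[of q T "x i + s"] by (simp add: add.assoc)
  qed
  then show ?thesis by (simp add: row_index_def)
qed

lemma gap_dvd:
  fixes y T :: nat
  assumes "T > 0"
  shows "T dvd y + (T - y mod T)"
proof -
  have "y + (T - y mod T) = (y - y mod T) + T"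
    using mod_less_divisor[OF assms, of y] mod_less_eq_dividend[of y T] by linarith
  then show ?thesis by (simp only: dvd_add dvd_minus_mod dvd_refl)
qed

lemma run_start_dvd:
  assumes "T > 0" "j < d"
  shows "T dvd x j + run_start d T x j"
proof -
  have "(x j + (T - x j mod T)) mod T = 0" 
    using gap_dvd[OF assms(1)] by (simp only: dvd_eq_mod_eq_0)
  then have "(x j + (T - x j mod T) mod T) mod T = 0" by (simp only: mod_add_right_eq)
  then show ?thesis using assms(2) by (simp only: run_start_def dvd_eq_mod_eq_0 if_True)
qed

lemma residue_complement_unique:
  fixes y r s T :: nat
  assumes "T dvd y + r" "T dvd y + s" "r < T" "s < T"
  shows "r = s"
proof -
  have le: "r \<le> s" if h: "T dvd y + r" "T dvd y + s" "r < T" for r s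
  proof (rule ccontr)
    assume "\<not> r \<le> s"
    then have "0 < r - s" "r - s < T" using h(3) by auto
    moreover have "T dvd r - s" using dvd_diff_nat[OF h(1,2)] by (simp only: diff_cancel2 add_diff_cancel_left diff_diff_left)
    ultimately show False using nat_dvd_not_less by blast
  qed
  show ?thesis using le[OF assms(1,2,3)] le[OF assms(2,1,4)] by simp
qed

text \<open>A coordinate meets a boundary at exactly one shift in \<open>[0, T)\<close>. The
  \<open>d\<close> coordinates and the shift 0 thus account for all starts of runs, at most
  \<open>d + 1\<close> per level.\<close>

lemma run_start_unique:
  assumes "T > 0" "r < T" "j < d" "T dvd x j + r"
  shows "r = run_start d T x j"
  using residue_complement_unique[OF assms(4) run_start_dvd[OF assms(1,3), of x] assms(2)
    run_start_less[OF assms(1), of d x j]] .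

lemma gap_le:
  fixes y q T :: nat
  assumes "T dvd y + q" "q > 0"
  shows "T - y mod T \<le> q"
proof (rule ccontr)
  assume "\<not> ?thesis"
  then have q: "q < T - y mod T" by simp
  have "(y mod T + q) mod T = 0"
    using assms(1) by (simp only: mod_add_left_eq dvd_eq_mod_eq_0)
  moreover have "y mod T + q < T" using q by simp
  ultimately have "y mod T + q = 0" by (simp only: mod_less)
  then show False using assms(2) by simp
qed

text \<open>A start strictly after \<open>s\<close> and not after \<open>r\<close> would be a
  crossing of coordinate \<open>j\<close> inside the run of \<open>s\<close>. Used in both
  directions, this shows that two runs that meet have the same start.\<close>

lemma runs_disjoint:
  assumes "T > 0" "s \<le> r" "r < s + run_length T x s d" "run_start d T x j \<le> r"
  shows "run_start d T x j \<le> s"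
proof (rule ccontr)
  let ?u = "run_start d T x j"
  assume "\<not> ?thesis"
  then have u: "s < ?u" by simp
  then have j: "j < d" by (auto simp: run_start_def split: if_splits)
  have "T dvd (x j + s) + (?u - s)"
    using run_start_dvd[OF assms(1) j, of x] u by (simp only: add.assoc le_add_diff_inverse less_imp_le)
  then have "T - (x j + s) mod T \<le> ?u - s" using u by (intro gap_le) auto
  moreover have "r - s < T - (x j + s) mod T"
    using less_run_length_iff[of "r - s" T x s d] assms(2,3) j by auto
  ultimately show False using assms(4) u by linarith
qed

text \<open>The run to take is that of the last start not after \<open>r\<close>: a boundary crossed
  in between would itself be a later start.\<close>

lemma runs_cover:
  assumes "r < T"
  obtains j where "j \<le> d" "run_start d T x j \<le> r"
    "r < run_start d T x j + run_length T x (run_start d T x j) d"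
proof -
  have T: "T > 0" using assms by simp
  let ?S = "{s. s \<le> r \<and> (\<exists>j\<le>d. s = run_start d T x j)}"
  define s where "s = Max ?S"
  have fin: "finite ?S" by (rule finite_subset[of _ "{..r}"]) auto
  have "0 \<in> ?S" by (auto intro!: exI[of _ d] simp: run_start_def)
  then have sS: "s \<in> ?S" unfolding s_def using fin Max_in by blast
  then obtain j where j: "j \<le> d" "s = run_start d T x j" "s \<le> r" by blast
  have "r - s < T - (x i + s) mod T" if i: "i < d" for i
  proof (rule ccontr)
    assume "\<not> ?thesis"
    then have le: "s + (T - (x i + s) mod T) \<le> r" using j(3) by linarith
    have "T dvd x i + (s + (T - (x i + s) mod T))"
      using gap_dvd[OF T, of "x i + s"] by (simp add: add.assoc)
    then have "s + (T - (x i + s) mod T) = run_start d T x i"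
      using le assms i T by (intro run_start_unique) auto
    then have "s + (T - (x i + s) mod T) \<in> ?S" using le i by (auto intro!: exI[of _ i])
    then have "s + (T - (x i + s) mod T) \<le> s" using Max_ge[OF fin] unfolding s_def by blast
    then show False using mod_less_divisor[OF T, of "x i + s"] by linarith
  qed
  then have "r - s < run_length T x s d"
    using diff_less_mono[OF assms j(3)] by (simp add: less_run_length_iff)
  then have "r < s + run_length T x s d" using j(3) by linarith
  then show ?thesis using that[OF j(1)] j(2,3) by simp
qed

section \<open>Counting the shifts that separate two points\<close>

lemma sum_shifted_div:
  fixes T x :: nat
  assumes "T > 0"
  shows "(\<Sum>r<T. (x + r) div T) = x"
proof (induction x)
  case 0
  then show ?case by simp
next
  case (Suc x)
  \<comment> \<open>Passing from \<open>x\<close> to \<open>Suc x\<close> drops the term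
    \<open>x div T\<close> and adds \<open>(x + T) div T\<close>, which is larger by one.\<close>
  have "(\<Sum>r<T. (Suc x + r) div T) + x div T = (\<Sum>r<Suc T. (x + r) div T)"
    by (subst sum.lessThan_Suc_shift) simp
  also have "\<dots> = x + Suc (x div T)" using Suc assms by simp
  finally show ?case by simp
qed

text \<open>Every separating shift contributes at least 1 to the sum of the differences of the
  quotients, and Hermite's identity evaluates that sum to \<open>y - x\<close>.\<close>

lemma card_shifts_separating_le:
  fixes T x y :: nat
  assumes "T > 0" "x \<le> y"
  shows "card {r. r < T \<and> (x + r) div T \<noteq> (y + r) div T} \<le> y - x"
proof -
  have le: "(x + r) div T \<le> (y + r) div T" for r using assms by (intro div_le_mono) simp
  have "card {r. r < T \<and> (x + r) div T \<noteq> (y + r) div T}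
      = (\<Sum>r<T. if (x + r) div T \<noteq> (y + r) div T then 1 else 0)"
    by (subst sum.If_cases) (auto intro!: arg_cong[where f = card])
  also have "\<dots> \<le> (\<Sum>r<T. (y + r) div T - (x + r) div T)"
    using le by (intro sum_mono) (auto simp: Suc_le_eq intro: le_neq_implies_less)
  also have "\<dots> = y - x" using le assms by (simp add: sum_subtractf_nat sum_shifted_div)
  finally show ?thesis .
qed

lemma card_shifts_separating_le_diff:
  fixes T x y :: nat
  assumes "T > 0"
  shows "real (card {r. r < T \<and> (x + r) div T \<noteq> (y + r) div T}) \<le> \<bar>real x - real y\<bar>"
proof (cases "x \<le> y")
  case True
  then show ?thesis using card_shifts_separating_le[OF assms True] by linarith
next
  case False
  then have "y \<le> x" by simp
  moreover have "{r. r < T \<and> (x + r) div T \<noteq> (y + r) div T} = {r. r < T \<and> (y + r) div T \<noteq> (x + r) div T}"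
    by auto
  ultimately have "card {r. r < T \<and> (x + r) div T \<noteq> (y + r) div T} \<le> x - y"
    using card_shifts_separating_le[OF assms, of y x] by simp
  then show ?thesis using False by linarith
qed

lemma card_shifts_separating_points:
  assumes "T > 0"
  shows "real (card {r. r < T \<and> (\<exists>k<d. (x k + r) div T \<noteq> (y k + r) div T)}) \<le> coord_dist d x y"
proof -
  have "{r. r < T \<and> (\<exists>k<d. (x k + r) div T \<noteq> (y k + r) div T)} =
      (\<Union>k<d. {r. r < T \<and> (x k + r) div T \<noteq> (y k + r) div T})" by auto
  then have "real (card {r. r < T \<and> (\<exists>k<d. (x k + r) div T \<noteq> (y k + r) div T)})
      \<le> real (\<Sum>k<d. card {r. r < T \<and> (x k + r) div T \<noteq> (y k + r) div T})"
    using card_UN_le[of "{..<d}" "\<lambda>k. {r. r < T \<and> (x k + r) div T \<noteq> (y k + r) div T}"]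
    by (simp only: of_nat_le_iff finite_lessThan)
  also have "\<dots> \<le> coord_dist d x y"
    unfolding coord_dist_def of_nat_sum
    by (intro sum_mono card_shifts_separating_le_diff assms)
  finally show ?thesis .
qed

section \<open>Routing along the hierarchy\<close>

lemma sum_mod_period:
  fixes f :: "nat \<Rightarrow> real"
  assumes "T > 0"
  shows "(\<Sum>r<m * T. f (r mod T)) = real m * (\<Sum>r<T. f r)"
proof -
  have "(\<Sum>r=i * T..<i * T + T. f (r mod T)) = (\<Sum>r<T. f r)" for i
  proof -
    have "(\<Sum>r=i * T..<i * T + T. f (r mod T)) = (\<Sum>r=0..<T. f ((r + i * T) mod T))"
      using sum.shift_bounds_nat_ivl[of "\<lambda>r. f (r mod T)" 0 "i * T" T] by (simp add: add.commute)
    also have "\<dots> = (\<Sum>r<T. f r)" by (intro sum.cong) (auto simp: lessThan_atLeast0)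
    finally show ?thesis .
  qed
  then show ?thesis by (simp flip: sum.nat_group[of _ T m])
qed

lemma ex_le_average:
  fixes c :: "nat \<Rightarrow> real"
  assumes "(\<Sum>r<m. c r) \<le> real m * K" "m > 0"
  obtains r where "r < m" "c r \<le> K"
proof -
  have "\<exists>r<m. c r \<le> K"
  proof (rule ccontr)
    assume "\<not> ?thesis"
    then have "(\<Sum>r<m. K) < (\<Sum>r<m. c r)" using assms(2) by (intro sum_strict_mono) auto
    then show False using assms(1) by simp
  qed
  then show ?thesis using that by blast
qed

lemma coord_dist_commute: "coord_dist d x y = coord_dist d y x"
  by (simp add: coord_dist_def abs_minus_commute)

lemma coord_dist_same_cell:
  assumes "T > 0" "\<And>k. k < d \<Longrightarrow> (x k + r) div T = (y k + r) div T"
  shows "coord_dist d x y \<le> real d * real T"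
proof -
  have "\<bar>real (x k) - real (y k)\<bar> \<le> real T" if "k < d" for k
  proof -
    have "(x k + r) div T * T + (x k + r) mod T = x k + r" by (simp only: div_mult_mod_eq)
    moreover have "(x k + r) div T * T + (y k + r) mod T = y k + r"
      by (simp only: assms(2)[OF that] div_mult_mod_eq)
    moreover have "(x k + r) mod T < T" "(y k + r) mod T < T" using assms(1) by simp_all
    ultimately have "x k \<le> y k + T" "y k \<le> x k + T" by linarith+
    then show ?thesis by linarith
  qed
  then have "coord_dist d x y \<le> (\<Sum>k<d. real T)"
    unfolding coord_dist_def by (intro sum_mono) auto
  then show ?thesis by simp
qed

section \<open>The hierarchy of cells over the points\<close>

locale vertex_grid =
  fixes n d l :: nat and \<phi> :: "nat \<Rightarrow> nat \<Rightarrow> nat"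
  assumes coord_range: "\<And>v k. v < n \<Longrightarrow> k < d \<Longrightarrow> \<phi> v k \<in> {1..2 ^ l}"
begin

text \<open>Exceeds every digit of a row: a coordinate plus a shift of level at most
  \<open>l\<close> stays below \<open>2 ^ Suc l\<close>.\<close>

definition base :: nat where "base = 2 * 2 ^ l"

definition same_cell :: "nat \<Rightarrow> nat \<Rightarrow> nat \<Rightarrow> nat \<Rightarrow> bool" where
  "same_cell t r u v \<longleftrightarrow> (\<forall>k<d. (\<phi> u k + r) div 2 ^ t = (\<phi> v k + r) div 2 ^ t)"

definition grid_row :: "nat \<Rightarrow> nat \<Rightarrow> nat \<Rightarrow> nat" where
  "grid_row t r v = row_index base d (2 ^ t) (\<phi> v) r"

text \<open>Taking the least vertex makes the choice depend on the cell only, so that all demand of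
  a cell is gathered at one place.\<close>

definition rep :: "nat \<Rightarrow> nat \<Rightarrow> nat \<Rightarrow> nat" where
  "rep t r v = (LEAST u. u < n \<and> same_cell t r u v)"

lemma pow_le: "t \<le> l \<Longrightarrow> (2::nat) ^ t \<le> 2 ^ l"
  by (rule power_increasing) auto

lemma shift_less_base: "t \<le> l \<Longrightarrow> r < 2 ^ t \<Longrightarrow> r < base"
  unfolding base_def using pow_le[of t] by linarith

lemma digit_less_base:
  assumes "t \<le> l" "r < 2 ^ t" "v < n" "k < d"
  shows "(\<phi> v k + r) div 2 ^ t < base"
proof -
  have "(\<phi> v k + r) div 2 ^ t \<le> \<phi> v k + r" by (rule div_le_dividend)
  also have "\<dots> < base"
    using coord_range[OF assms(3,4)] assms(2) pow_le[OF assms(1)] unfolding base_def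
    by (auto simp del: power_increasing_iff)
  finally show ?thesis .
qed

lemma row_eq_iff:
  assumes "t \<le> l" "r < 2 ^ t" "u < n" "t' \<le> l" "r' < 2 ^ t'" "v < n"
  shows "grid_row t r u = grid_row t' r' v \<longleftrightarrow> t = t' \<and> r = r' \<and> same_cell t r u v"
proof -
  have "grid_row t r u = grid_row t' r' v \<longleftrightarrow>
      r = r' \<and> (2::nat) ^ t = 2 ^ t' \<and> (\<forall>k<d. (\<phi> u k + r) div 2 ^ t = (\<phi> v k + r) div 2 ^ t)"
    unfolding grid_row_def using assms
    by (intro row_index_eq_iff) (auto intro: shift_less_base digit_less_base)
  then show ?thesis by (auto simp: same_cell_def)
qed

lemma row_less:
  assumes "t \<le> l" "r < 2 ^ t" "v < n"
  shows "grid_row t r v < base ^ (d + 2)"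
proof -
  have "2 ^ t < base" using pow_le[OF assms(1)] zero_less_power[of "2::nat" l] unfolding base_def by linarith
  then show ?thesis unfolding grid_row_def using assms
    by (intro row_index_less) (auto intro: shift_less_base digit_less_base)
qed

lemma same_cell_refl: "same_cell t r v v"
  by (simp add: same_cell_def)

lemma same_cell_sym: "same_cell t r u v \<Longrightarrow> same_cell t r v u"
  by (simp add: same_cell_def)

lemma same_cell_cong: "same_cell t r u v \<Longrightarrow> same_cell t r z u \<longleftrightarrow> same_cell t r z v"
  by (auto simp: same_cell_def)

lemma same_cell_Suc:
  assumes "same_cell t r u v" shows "same_cell (Suc t) r u v"
proof -
  have "x div 2 ^ Suc t = x div 2 ^ t div 2" for x :: nat
    by (simp add: div_mult2_eq power_Suc2 del: power_Suc)
  then show ?thesis using assms by (auto simp only: same_cell_def)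
qed

text \<open>Coordinates shifted by less than \<open>2 ^ l\<close> stay below
  \<open>2 ^ Suc l\<close>, so level \<open>Suc l\<close> is a single cell. It serves as the root of
  the hierarchy and has no rows in the matrix.\<close>

lemma same_cell_top:
  assumes "r < 2 ^ l" "u < n" "v < n" shows "same_cell (Suc l) r u v"
proof -
  have "(\<phi> z k + r) div 2 ^ Suc l = 0" if "z < n" "k < d" for z k
    using coord_range[OF that] assms(1) by (intro div_less) auto
  then show ?thesis using assms by (simp add: same_cell_def)
qed

text \<open>A shift by a multiple of the side moves the grid onto itself. This lets one shift
  \<open>r < 2 ^ l\<close> act on all levels although level \<open>t\<close> has rows for
  \<open>r < 2 ^ t\<close> only.\<close>

lemma same_cell_mod: "same_cell t (r mod 2 ^ t) u v \<longleftrightarrow> same_cell t r u v"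
proof -
  have "(x + r) div 2 ^ t = (x + r mod 2 ^ t) div 2 ^ t + r div 2 ^ t" for x
  proof -
    have "x + r = (x + r mod 2 ^ t) + r div 2 ^ t * 2 ^ t"
      using div_mult_mod_eq[of r "2 ^ t"] by linarith
    then show ?thesis by (metis div_mult_self1 add.commute power_not_zero zero_neq_numeral)
  qed
  then show ?thesis by (simp add: same_cell_def)
qed

lemma coord_dist_le: "same_cell t r u v \<Longrightarrow> coord_dist d (\<phi> u) (\<phi> v) \<le> real d * 2 ^ t"
  using coord_dist_same_cell[of "2 ^ t" d "\<phi> u" r "\<phi> v"] by (simp add: same_cell_def)

lemma rep_props:
  assumes "v < n" shows "rep t r v < n" "same_cell t r (rep t r v) v"
  using LeastI[of "\<lambda>u. u < n \<and> same_cell t r u v" v] assms same_cell_refl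
  unfolding rep_def by auto

lemma rep_cong: "same_cell t r u v \<Longrightarrow> rep t r u = rep t r v"
  by (simp add: rep_def same_cell_cong)

lemma rep_eq_iff:
  assumes "u < n" "v < n" shows "rep t r u = rep t r v \<longleftrightarrow> same_cell t r u v"
  using rep_cong rep_props(2)[OF assms(1), of t r] rep_props(2)[OF assms(2), of t r]
    same_cell_cong same_cell_sym by metis

lemma rep_Suc: "v < n \<Longrightarrow> rep (Suc t) r (rep t r v) = rep (Suc t) r v"
  by (intro rep_cong same_cell_Suc rep_props)

lemma rep_mod: "rep t (r mod 2 ^ t) v = rep t r v"
  by (simp add: rep_def same_cell_mod)

text \<open>The 1-norm of the vector of cell sums. Cells are indexed by their representatives; a
  \<open>u\<close> that represents no cell contributes an empty sum.\<close>

definition cell_norm :: "(nat \<Rightarrow> real) \<Rightarrow> nat \<Rightarrow> nat \<Rightarrow> real" where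
  "cell_norm b t r = (\<Sum>u<n. \<bar>\<Sum>v | v < n \<and> rep t r v = u. b v\<bar>)"

text \<open>Among the \<open>2 ^ l\<close> shifts each residue modulo \<open>2 ^ t\<close> occurs
  \<open>2 ^ (l - t)\<close> times, so the factor \<open>2 ^ t\<close> in the cost cancels in the
  average and every level is left with \<open>2 * real d\<close>. Some shift is no worse than the
  average.\<close>

lemma ex_good_shift:
  obtains r where "r < 2 ^ l"
    "(\<Sum>t\<le>l. real d * 2 ^ Suc t * cell_norm b t r) \<le> 2 * real d * (\<Sum>t\<le>l. \<Sum>r<2 ^ t. cell_norm b t r)"
proof (rule ex_le_average)
  have "(\<Sum>r<2 ^ l. \<Sum>t\<le>l. real d * 2 ^ Suc t * cell_norm b t r)
      = (\<Sum>t\<le>l. \<Sum>r<2 ^ l. real d * 2 ^ Suc t * cell_norm b t r)"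
    by (rule sum.swap)
  also have "\<dots> = (\<Sum>t\<le>l. real d * 2 ^ Suc t * (2 ^ (l - t) * (\<Sum>r<2 ^ t. cell_norm b t r)))"
  proof (intro sum.cong refl)
    fix t assume "t \<in> {..l}"
    then have e: "(2::nat) ^ l = 2 ^ (l - t) * 2 ^ t" by (simp flip: power_add)
    have "(\<Sum>r<2 ^ l. cell_norm b t r) = (\<Sum>r<2 ^ l. cell_norm b t (r mod 2 ^ t))"
      by (simp add: cell_norm_def rep_mod)
    also have "\<dots> = 2 ^ (l - t) * (\<Sum>r<2 ^ t. cell_norm b t r)"
      unfolding e using sum_mod_period[of "2 ^ t" "cell_norm b t" "2 ^ (l - t)"] by simp
    finally show "(\<Sum>r<2 ^ l. real d * 2 ^ Suc t * cell_norm b t r) =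
        real d * 2 ^ Suc t * (2 ^ (l - t) * (\<Sum>r<2 ^ t. cell_norm b t r))"
      by (simp flip: sum_distrib_left)
  qed
  also have "\<dots> = (\<Sum>t\<le>l. 2 ^ l * (2 * real d) * (\<Sum>r<2 ^ t. cell_norm b t r))"
  proof (intro sum.cong refl)
    fix t assume "t \<in> {..l}"
    then have e: "(2::real) ^ l = 2 ^ (l - t) * 2 ^ t" by (simp flip: power_add)
    show "real d * 2 ^ Suc t * (2 ^ (l - t) * (\<Sum>r<2 ^ t. cell_norm b t r)) =
        2 ^ l * (2 * real d) * (\<Sum>r<2 ^ t. cell_norm b t r)"
      unfolding e by simp
  qed
  finally show "(\<Sum>r<2 ^ l. \<Sum>t\<le>l. real d * 2 ^ Suc t * cell_norm b t r)
      \<le> real (2 ^ l) * (2 * real d * (\<Sum>t\<le>l. \<Sum>r<2 ^ t. cell_norm b t r))"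
    by (simp add: sum_distrib_left mult.assoc)
qed simp_all

text \<open>For a fixed shift the cells form a hierarchy, and each vertex is routed to the root along the
  representatives of its cells: the demand of a cell at level \<open>t\<close> moves inside one cell of level
  \<open>t + 1\<close>. The shift is chosen by averaging.\<close>

lemma transport:
  fixes M :: "nat \<Rightarrow> nat \<Rightarrow> real" and b :: "nat \<Rightarrow> real"
  assumes inj: "\<And>u v. u < n \<Longrightarrow> v < n \<Longrightarrow> (\<forall>k<d. \<phi> u k = \<phi> v k) \<Longrightarrow> u = v"
    and balanced: "(\<Sum>v<n. b v) = 0"
    and route: "\<And>u v. u < n \<Longrightarrow> v < n \<Longrightarrow> \<exists>x. (\<forall>i<n. (\<Sum>j<m. M i j * x j) = of_bool (i = u) - of_bool (i = v)) \<and>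
      (\<Sum>j<m. \<bar>x j\<bar>) \<le> coord_dist d (\<phi> u) (\<phi> v)"
  shows "\<exists>x. (\<forall>i<n. (\<Sum>j<m. M i j * x j) = b i) \<and>
    (\<Sum>j<m. \<bar>x j\<bar>) \<le> 2 * real d * (\<Sum>t\<le>l. \<Sum>r<2 ^ t. cell_norm b t r)"
proof -
  obtain f where f: "\<And>u v i. u < n \<Longrightarrow> v < n \<Longrightarrow> i < n \<Longrightarrow>
      (\<Sum>j<m. M i j * f u v j) = of_bool (i = u) - of_bool (i = v)"
    and f_norm: "\<And>u v. u < n \<Longrightarrow> v < n \<Longrightarrow> (\<Sum>j<m. \<bar>f u v j\<bar>) \<le> coord_dist d (\<phi> u) (\<phi> v)"
    using route by metis
  obtain r where r: "r < 2 ^ l" and cost: "(\<Sum>t\<le>l. real d * 2 ^ Suc t * cell_norm b t r)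
      \<le> 2 * real d * (\<Sum>t\<le>l. \<Sum>r<2 ^ t. cell_norm b t r)"
    using ex_good_shift by blast
  define \<beta> where "\<beta> t u = (\<Sum>v | v < n \<and> rep t r v = u. b v)" for t u
  have group: "(\<Sum>u<n. \<beta> t u * g u) = (\<Sum>v<n. b v * g (rep t r v))" for t and g :: "nat \<Rightarrow> real"
  proof -
    have "(\<Sum>u<n. \<beta> t u * g u) = (\<Sum>u<n. \<Sum>v | v \<in> {..<n} \<and> rep t r v = u. b v * g (rep t r v))"
      unfolding \<beta>_def sum_distrib_right by (intro sum.cong) auto
    also have "\<dots> = (\<Sum>v<n. b v * g (rep t r v))"
      by (rule sum.group) (auto simp: rep_props)
    finally show ?thesis .
  qed
  \<comment> \<open>On every level the demand of a cell waits at its representative and is sent to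
    the representative of the parent cell.\<close>
  define x where "x j = (\<Sum>t\<le>l. \<Sum>u<n. \<beta> t u * f u (rep (Suc t) r u) j)" for j
  have "(\<Sum>j<m. M i j * x j) = b i" if i: "i < n" for i
  proof -
    \<comment> \<open>\<open>D t\<close> is the demand found at \<open>i\<close> once everything
      sits at representatives of level \<open>t\<close>. The flow of level \<open>t\<close> realises
      \<open>D t - D (Suc t)\<close>, so the levels telescope.\<close>
    define D where "D t = (\<Sum>v<n. b v * of_bool (i = rep t r v))" for t
    have "(\<Sum>j<m. M i j * x j)
        = (\<Sum>j<m. \<Sum>t\<le>l. \<Sum>u<n. \<beta> t u * (M i j * f u (rep (Suc t) r u) j))"
      by (simp add: x_def sum_distrib_left algebra_simps)
    also have "\<dots> = (\<Sum>t\<le>l. \<Sum>j<m. \<Sum>u<n. \<beta> t u * (M i j * f u (rep (Suc t) r u) j))"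
      by (rule sum.swap)
    also have "\<dots> = (\<Sum>t\<le>l. \<Sum>u<n. \<Sum>j<m. \<beta> t u * (M i j * f u (rep (Suc t) r u) j))"
      by (intro sum.cong refl sum.swap)
    also have "\<dots> = (\<Sum>t\<le>l. \<Sum>u<n. \<beta> t u * (of_bool (i = u) - of_bool (i = rep (Suc t) r u)))"
      using i by (intro sum.cong refl) (simp add: f rep_props flip: sum_distrib_left)
    also have "\<dots> = (\<Sum>t\<le>l. D t - D (Suc t))"
      unfolding D_def by (intro sum.cong refl) (simp add: group rep_Suc right_diff_distrib sum_subtractf)
    also have "\<dots> = D 0 - D (Suc l)" by (rule sum_telescope)
    also have "D 0 = b i"
    proof -
      \<comment> \<open>Cells of level 0 have side 1, so injectivity of \<phi> makes each of them a
        single vertex.\<close>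
      have "rep 0 r v = v" if v: "v < n" for v
        using inj[OF rep_props(1)[OF v] v] rep_props(2)[OF v, of 0 r] by (simp add: same_cell_def)
      then have "D 0 = (\<Sum>v<n. if v = i then b v else 0)"
        unfolding D_def by (intro sum.cong) auto
      then show ?thesis using i by simp
    qed
    also have "D (Suc l) = 0"
    proof -
      \<comment> \<open>All vertices share the root, where the total demand arrives, and that total
        is 0.\<close>
      have "rep (Suc l) r v = rep (Suc l) r i" if "v < n" for v
        using rep_cong same_cell_top r i that by blast
      then have "D (Suc l) = (\<Sum>v<n. b v * of_bool (i = rep (Suc l) r i))"
        unfolding D_def by (intro sum.cong) auto
      then show ?thesis using balanced by (simp flip: sum_distrib_right)
    qed
    finally show ?thesis by simp
  qed
  moreover have "(\<Sum>j<m. \<bar>x j\<bar>) \<le> 2 * real d * (\<Sum>t\<le>l. \<Sum>r<2 ^ t. cell_norm b t r)"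
  proof -
    have "(\<Sum>j<m. \<bar>x j\<bar>) \<le> (\<Sum>j<m. \<Sum>t\<le>l. \<Sum>u<n. \<bar>\<beta> t u\<bar> * \<bar>f u (rep (Suc t) r u) j\<bar>)"
      unfolding x_def
      by (intro sum_mono order.trans[OF sum_abs] order.trans[OF sum_abs sum_mono])
        (simp add: abs_mult)
    also have "\<dots> = (\<Sum>t\<le>l. \<Sum>j<m. \<Sum>u<n. \<bar>\<beta> t u\<bar> * \<bar>f u (rep (Suc t) r u) j\<bar>)"
      by (rule sum.swap)
    also have "\<dots> = (\<Sum>t\<le>l. \<Sum>u<n. \<Sum>j<m. \<bar>\<beta> t u\<bar> * \<bar>f u (rep (Suc t) r u) j\<bar>)"
      by (intro sum.cong refl sum.swap)
    also have "\<dots> = (\<Sum>t\<le>l. \<Sum>u<n. \<bar>\<beta> t u\<bar> * (\<Sum>j<m. \<bar>f u (rep (Suc t) r u) j\<bar>))"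
      by (simp add: sum_distrib_left)
    also have "\<dots> \<le> (\<Sum>t\<le>l. \<Sum>u<n. \<bar>\<beta> t u\<bar> * (real d * 2 ^ Suc t))"
    proof (intro sum_mono mult_left_mono)
      fix t u assume "u \<in> {..<n}"
      then have u: "u < n" by simp
      \<comment> \<open>Source and target lie in one cell of level \<open>Suc t\<close>, the parent,
        whose diameter is at most \<open>d\<close> times its side.\<close>
      show "(\<Sum>j<m. \<bar>f u (rep (Suc t) r u) j\<bar>) \<le> real d * 2 ^ Suc t"
        using f_norm[OF u rep_props(1)[OF u]] coord_dist_le[OF same_cell_sym[OF rep_props(2)[OF u]]]
        by (rule order.trans)
    qed simp
    also have "\<dots> = (\<Sum>t\<le>l. real d * 2 ^ Suc t * cell_norm b t r)"
      by (simp add: cell_norm_def \<beta>_def mult.commute flip: sum_distrib_left sum_distrib_right)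
    finally show ?thesis using cost by linarith
  qed
  ultimately show ?thesis by blast
qed

text \<open>Phrased by encoding the cells of \<open>v\<close> instead of decoding \<rho>, so that
  the gaps in the numbering become zero rows by themselves.\<close>

definition entry :: "nat \<Rightarrow> nat \<Rightarrow> real" where
  "entry \<rho> v = of_bool (\<exists>t\<le>l. \<exists>r<2 ^ t. \<rho> = grid_row t r v)"

lemma entry_row:
  assumes "t \<le> l" "r < 2 ^ t" "u < n" "v < n"
  shows "entry (grid_row t r u) v = of_bool (same_cell t r u v)"
  using assms row_eq_iff[OF assms(1-3) _ _ assms(4)] unfolding entry_def by auto

text \<open>Each triple of level, shift and representative owns a row of its own, whose product with
  \<open>b\<close> is the sum over that cell. The remaining rows can only increase the norm.\<close>

lemma cell_norm_le_norm:
  "(\<Sum>t\<le>l. \<Sum>r<2 ^ t. cell_norm b t r) \<le> (\<Sum>\<rho><base ^ (d + 2). \<bar>\<Sum>v<n. entry \<rho> v * b v\<bar>)"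
proof -
  let ?g = "\<lambda>\<rho>. \<bar>\<Sum>v<n. entry \<rho> v * b v\<bar>"
  let ?I = "SIGMA t:{..l}. SIGMA r:{..<2 ^ t}. {u. u < n \<and> rep t r u = u}"
  let ?h = "\<lambda>(t, r, u). grid_row t r u"
  have cell: "cell_norm b t r = (\<Sum>u | u < n \<and> rep t r u = u. ?g (grid_row t r u))"
    if "t \<le> l" "r < 2 ^ t" for t r
  proof -
    have "cell_norm b t r = (\<Sum>u | u < n \<and> rep t r u = u. \<bar>\<Sum>v | v < n \<and> rep t r v = u. b v\<bar>)"
      unfolding cell_norm_def
    proof (rule sum.mono_neutral_right)
      show "\<forall>u\<in>{..<n} - {u. u < n \<and> rep t r u = u}. \<bar>\<Sum>v | v < n \<and> rep t r v = u. b v\<bar> = 0"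
      proof
        fix u assume u: "u \<in> {..<n} - {u. u < n \<and> rep t r u = u}"
        have "rep t r (rep t r v) = rep t r v" if "v < n" for v
          using rep_cong rep_props(2)[OF that] by blast
        then have "{v. v < n \<and> rep t r v = u} = {}" using u by auto
        then show "\<bar>\<Sum>v | v < n \<and> rep t r v = u. b v\<bar> = 0" by (simp only: sum.empty abs_zero)
      qed
    qed auto
    also have "\<dots> = (\<Sum>u | u < n \<and> rep t r u = u. ?g (grid_row t r u))"
    proof (rule sum.cong[OF refl])
      fix u assume u: "u \<in> {u. u < n \<and> rep t r u = u}"
      have "(\<Sum>v<n. entry (grid_row t r u) v * b v) = (\<Sum>v<n. if rep t r v = u then b v else 0)"
      proof (intro sum.cong refl)
        fix v assume "v \<in> {..<n}"
        then show "entry (grid_row t r u) v * b v = (if rep t r v = u then b v else 0)"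
          using u that rep_eq_iff[of u v t r] by (auto simp: entry_row)
      qed
      also have "\<dots> = (\<Sum>v | v < n \<and> rep t r v = u. b v)"
        by (subst sum.inter_filter[symmetric]) auto
      finally show "\<bar>\<Sum>v | v < n \<and> rep t r v = u. b v\<bar> = ?g (grid_row t r u)" by simp
    qed
    finally show ?thesis .
  qed
  have "(\<Sum>t\<le>l. \<Sum>r<2 ^ t. cell_norm b t r)
      = (\<Sum>t\<le>l. \<Sum>r<2 ^ t. \<Sum>u | u < n \<and> rep t r u = u. ?g (grid_row t r u))"
    by (intro sum.cong refl) (auto simp: cell)
  also have "\<dots> = (\<Sum>p\<in>?I. ?g (?h p))"
    by (simp add: sum.Sigma split_def)
  also have "\<dots> = (\<Sum>\<rho>\<in>?h ` ?I. ?g \<rho>)"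
  proof -
    have "inj_on ?h ?I"
    proof (rule inj_onI, clarsimp)
      fix t r u t' r' u'
      assume h: "t \<le> l" "r < 2 ^ t" "u < n" "rep t r u = u"
        "t' \<le> l" "r' < 2 ^ t'" "u' < n" "rep t' r' u' = u'" "grid_row t r u = grid_row t' r' u'"
      then have "t = t' \<and> r = r' \<and> same_cell t r u u'" using row_eq_iff by blast
      then show "t = t' \<and> r = r' \<and> u = u'" using h rep_cong by metis
    qed
    then show ?thesis by (simp add: sum.reindex)
  qed
  also have "\<dots> \<le> (\<Sum>\<rho><base ^ (d + 2). ?g \<rho>)"
    by (intro sum_mono2) (auto intro!: row_less simp del: power_Suc add_2_eq_Suc')
  finally show ?thesis .
qed

text \<open>Two columns differ only in rows of shifts that separate the points. There are at most
  \<open>coord_dist\<close> such shifts on each of the \<open>l + 1\<close> levels, and each affects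
  one row on either side, whence the factor 2.\<close>

lemma sum_entry_diff_le:
  assumes "u < n" "v < n"
  shows "(\<Sum>\<rho><R. \<bar>entry \<rho> u - entry \<rho> v\<bar>) \<le> 2 * (real l + 1) * coord_dist d (\<phi> u) (\<phi> v)"
proof -
  define S where "S v = {\<rho>. \<exists>t\<le>l. \<exists>r<2 ^ t. \<rho> = grid_row t r v}" for v
  have one_sided: "(\<Sum>\<rho><R. of_bool (\<rho> \<in> S u - S v)) \<le> (real l + 1) * coord_dist d (\<phi> u) (\<phi> v)" for u v
  proof -
    let ?D = "SIGMA t:{..l}. {r. r < 2 ^ t \<and> (\<exists>k<d. (\<phi> u k + r) div 2 ^ t \<noteq> (\<phi> v k + r) div 2 ^ t)}"
    have "S u - S v \<subseteq> (\<lambda>(t, r). grid_row t r u) ` ?D"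
    proof
      fix \<rho> assume "\<rho> \<in> S u - S v"
      then obtain t r where tr: "t \<le> l" "r < 2 ^ t" "\<rho> = grid_row t r u" "\<rho> \<notin> S v"
        unfolding S_def by blast
      then have "grid_row t r u \<noteq> grid_row t r v" unfolding S_def by blast
      then have "\<exists>k<d. (\<phi> u k + r) div 2 ^ t \<noteq> (\<phi> v k + r) div 2 ^ t"
        unfolding grid_row_def row_index_def using cell_code_cong by (metis (no_types, lifting))
      then show "\<rho> \<in> (\<lambda>(t, r). grid_row t r u) ` ?D" using tr by force
    qed
    then have sub: "{\<rho> \<in> {..<R}. \<rho> \<in> S u - S v} \<subseteq> (\<lambda>(t, r). grid_row t r u) ` ?D" by blast
    have fin: "finite ?D" by (intro finite_SigmaI) auto
    have "(\<Sum>\<rho><R. of_bool (\<rho> \<in> S u - S v) :: real) = card {\<rho> \<in> {..<R}. \<rho> \<in> S u - S v}"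
      by (simp add: of_bool_def sum.If_cases Int_def del: Diff_iff)
    also have "\<dots> \<le> real (card ?D)"
      by (intro of_nat_mono order.trans[OF card_mono[OF finite_imageI[OF fin] sub] card_image_le[OF fin]])
    also have "\<dots> = (\<Sum>t\<le>l. real (card {r. r < 2 ^ t \<and> (\<exists>k<d. (\<phi> u k + r) div 2 ^ t \<noteq> (\<phi> v k + r) div 2 ^ t)}))"
      by (subst card_SigmaI) auto
    also have "\<dots> \<le> (\<Sum>t\<le>l. coord_dist d (\<phi> u) (\<phi> v))"
      by (intro sum_mono card_shifts_separating_points) simp
    finally show ?thesis by (simp add: add.commute)
  qed
  have "(\<Sum>\<rho><R. \<bar>entry \<rho> u - entry \<rho> v\<bar>)
      = (\<Sum>\<rho><R. of_bool (\<rho> \<in> S u - S v) + of_bool (\<rho> \<in> S v - S u))"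
    by (intro sum.cong refl) (auto simp: entry_def S_def)
  also have "\<dots> = (\<Sum>\<rho><R. of_bool (\<rho> \<in> S u - S v)) + (\<Sum>\<rho><R. of_bool (\<rho> \<in> S v - S u))"
    by (rule sum.distrib)
  also have "\<dots> \<le> (real l + 1) * coord_dist d (\<phi> u) (\<phi> v) + (real l + 1) * coord_dist d (\<phi> u) (\<phi> v)"
    using one_sided[of u v] one_sided[of v u] by (simp only: coord_dist_commute[of d "\<phi> v"] add_mono)
  finally show ?thesis by (simp add: algebra_simps)
qed

end

section \<open>Flows along walks\<close>

text \<open>Repeats the case distinction of \<open>incidence_mat\<close> literally, so that the two
  agree by reflexivity.\<close>

definition edge_sign :: "nat set \<Rightarrow> nat \<Rightarrow> real" where
  "edge_sign e i = (if \<exists>v. e = {i, v} \<and> i < v then 1 else if \<exists>v. e = {i, v} \<and> i > v then -1 else 0)"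

text \<open>Orientation amounts to one sign per edge: a flow absorbs it in the sign of its
  coordinate, and absolute values ignore it.\<close>

lemma edge_sign_doubleton:
  assumes "u \<noteq> v"
  shows "edge_sign {u, v} i = (if u < v then 1 else -1) * (of_bool (i = u) - of_bool (i = v))"
  using assms by (auto simp: edge_sign_def doubleton_eq_iff)

text \<open>The entries of \<open>A W^-1\<close>. With this scaling the 1-norm of a vector is the
  total cost of the flow that it encodes.\<close>

definition flow_entry :: "nat set list \<Rightarrow> (nat set \<Rightarrow> nat) \<Rightarrow> nat \<Rightarrow> nat \<Rightarrow> real" where
  "flow_entry es w i j = edge_sign (es ! j) i / real (w (es ! j))"

locale weighted_graph =
  fixes n :: nat and E :: "nat set set" and w :: "nat set \<Rightarrow> nat" and es :: "nat set list"
  assumes connected: "connected_weighted_graph n E w"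
    and edges: "set es = E"
begin

lemma edge_cases:
  assumes "e \<in> E"
  obtains u v where "e = {u, v}" "u \<noteq> v" "u < n" "v < n" "w e > 0"
proof -
  have "card e = 2" "e \<subseteq> {..<n}" "w e > 0"
    using connected assms unfolding connected_weighted_graph_def by blast+
  then show ?thesis using that unfolding card_2_iff by blast
qed

text \<open>Makes every image a balanced demand, as \<open>transport\<close> requires.\<close>

lemma sum_flow_entry:
  assumes "j < length es"
  shows "(\<Sum>i<n. flow_entry es w i j) = 0"
proof -
  have "es ! j \<in> E" using assms edges by auto
  then obtain u v where e: "es ! j = {u, v}" "u \<noteq> v" "u < n" "v < n" using edge_cases by metis
  have "(\<Sum>i<n. of_bool (i = u) - of_bool (i = v) :: real) = 0"
    using e(3,4) by (simp add: sum_subtractf of_bool_def sum.delta)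
  moreover have entry: "flow_entry es w i j =
      (if u < v then 1 else -1) / real (w (es ! j)) * (of_bool (i = u) - of_bool (i = v))" for i
    unfolding flow_entry_def e(1) edge_sign_doubleton[OF e(2)] by simp
  ultimately show ?thesis unfolding entry sum_distrib_left[symmetric] by simp
qed

text \<open>Prepending an edge adds its weight, with the orientation sign, to one coordinate; this
  moves one unit across the edge. A walk may use an edge repeatedly, where contributions can cancel,
  so the norm is only bounded by the weight.\<close>

lemma walk_flow:
  assumes "walk n E u p v"
  shows "\<exists>x. (\<forall>i. (\<Sum>j<length es. flow_entry es w i j * x j) = of_bool (i = u) - of_bool (i = v)) \<and>
    (\<Sum>j<length es. \<bar>x j\<bar>) \<le> real (walk_weight w p)"
  using assms
proof (induction p arbitrary: u)
  case Nil
  then show ?case by (simp add: walk_def)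
next
  case (Cons a p)
  show ?case
  proof (cases p)
    case Nil
    then have "u = v" using Cons.prems by (simp add: walk_def)
    then show ?thesis by (intro exI[of _ "\<lambda>_. 0"]) simp
  next
    case p: (Cons q p')
    have walk: "walk n E q p v" and uq: "{u, q} \<in> E"
      using Cons.prems unfolding walk_def p by auto
    obtain x where x: "\<And>i. (\<Sum>j<length es. flow_entry es w i j * x j) = of_bool (i = q) - of_bool (i = v)"
      "(\<Sum>j<length es. \<bar>x j\<bar>) \<le> real (walk_weight w p)"
      using Cons.IH[OF walk] by blast
    have ne: "u \<noteq> q" and w_pos: "w {u, q} > 0"
      using edge_cases[OF uq] by (metis doubleton_eq_iff, metis)
    obtain k where k: "k < length es" "es ! k = {u, q}"
      using uq edges by (metis in_set_conv_nth)
    define \<sigma> :: real where "\<sigma> = (if u < q then 1 else -1)"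
    define y where "y j = x j + (if j = k then \<sigma> * real (w {u, q}) else 0)" for j
    have "(\<Sum>j<length es. flow_entry es w i j * y j) = of_bool (i = u) - of_bool (i = v)" for i
    proof -
      have "(\<Sum>j<length es. flow_entry es w i j * y j) = (\<Sum>j<length es. flow_entry es w i j * x j) +
          (\<Sum>j<length es. if j = k then flow_entry es w i j * (\<sigma> * real (w {u, q})) else 0)"
        unfolding y_def distrib_left sum.distrib by (intro arg_cong2[where f = plus] sum.cong) auto
      also have "(\<Sum>j<length es. if j = k then flow_entry es w i j * (\<sigma> * real (w {u, q})) else 0)
          = flow_entry es w i k * (\<sigma> * real (w {u, q}))"
        using k(1) by simp
      also have "\<dots> = of_bool (i = u) - of_bool (i = q)"
        using w_pos unfolding flow_entry_def k(2) edge_sign_doubleton[OF ne] by (simp add: \<sigma>_def)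
      finally show ?thesis using x(1)[of i] by simp
    qed
    moreover have "(\<Sum>j<length es. \<bar>y j\<bar>) \<le> real (walk_weight w (a # p))"
    proof -
      have "(\<Sum>j<length es. \<bar>y j\<bar>) \<le> (\<Sum>j<length es. \<bar>x j\<bar> + (if j = k then real (w {u, q}) else 0))"
        by (intro sum_mono) (auto simp: y_def \<sigma>_def)
      also have "\<dots> = (\<Sum>j<length es. \<bar>x j\<bar>) + real (w {u, q})"
        using k(1) by (simp add: sum.distrib)
      also have "\<dots> \<le> real (walk_weight w p) + real (w {u, q})" using x(2) by simp
      also have "\<dots> = real (walk_weight w (a # p))"
      proof -
        have "a = u" using Cons.prems by (simp add: walk_def)
        then show ?thesis unfolding walk_weight_def p by (simp add: sum.lessThan_Suc_shift del: sum.lessThan_Suc)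
      qed
      finally show ?thesis .
    qed
    ultimately show ?thesis by blast
  qed
qed

text \<open>The infimum ranges over a nonempty set of natural numbers and is therefore attained by a
  walk.\<close>

lemma graph_dist_flow:
  assumes "u < n" "v < n"
  shows "\<exists>x. (\<forall>i. (\<Sum>j<length es. flow_entry es w i j * x j) = of_bool (i = u) - of_bool (i = v)) \<and>
    (\<Sum>j<length es. \<bar>x j\<bar>) \<le> real (graph_dist n E w u v)"
proof -
  have "{p. walk n E u p v} \<noteq> {}"
    using connected assms unfolding connected_weighted_graph_def by blast
  then have "graph_dist n E w u v \<in> walk_weight w ` {p. walk n E u p v}"
    unfolding graph_dist_def by (intro Inf_nat_def1) blast
  then obtain p where "walk n E u p v" "graph_dist n E w u v = walk_weight w p" by blast
  then show ?thesis using walk_flow by metis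
qed

text \<open>A flow of cost 0 is zero and cannot carry a unit between distinct vertices.\<close>

lemma graph_dist_pos:
  assumes "u < n" "v < n" "u \<noteq> v"
  shows "graph_dist n E w u v > 0"
proof (rule ccontr)
  assume "\<not> ?thesis"
  moreover obtain x where x: "\<And>i. (\<Sum>j<length es. flow_entry es w i j * x j) = of_bool (i = u) - of_bool (i = v)"
    "(\<Sum>j<length es. \<bar>x j\<bar>) \<le> real (graph_dist n E w u v)"
    using graph_dist_flow[OF assms(1,2)] by blast
  ultimately have "(\<Sum>j<length es. \<bar>x j\<bar>) \<le> 0" by simp
  then have "(\<Sum>j<length es. \<bar>x j\<bar>) = 0" by (intro antisym sum_nonneg) auto
  then have "\<forall>j<length es. x j = 0" by (simp add: sum_nonneg_eq_0_iff)
  then show False using x(1)[of u] assms(3) by simp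
qed

lemma graph_dist_edge:
  assumes "{u, v} \<in> E" "u < n" "v < n"
  shows "graph_dist n E w u v \<le> w {u, v}"
proof -
  have "walk n E u [u, v] v" using assms by (simp add: walk_def)
  then have "graph_dist n E w u v \<le> walk_weight w [u, v]"
    unfolding graph_dist_def by (intro cINF_lower) auto
  then show ?thesis by (simp add: walk_weight_def)
qed

end

section \<open>Matrices\<close>

lemma mult_mat_vec_nth:
  assumes "A \<in> carrier_mat r m" "x \<in> carrier_vec m" "i < r"
  shows "(A *\<^sub>v x) $ i = (\<Sum>j<m. A $$ (i, j) * x $ j)"
  using assms by (auto simp: scalar_prod_def lessThan_atLeast0 intro!: sum.cong)

lemma norm1_nonneg: "norm1 x \<ge> 0"
  by (simp add: norm1_def sum_nonneg)

lemma norm1_mult_le: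
  assumes "B \<in> carrier_mat r m" "x \<in> carrier_vec m"
    and cols: "\<And>j. j < m \<Longrightarrow> (\<Sum>i<r. \<bar>B $$ (i, j)\<bar>) \<le> c"
  shows "norm1 (B *\<^sub>v x) \<le> c * norm1 x"
proof -
  have "norm1 (B *\<^sub>v x) = (\<Sum>i<r. \<bar>\<Sum>j<m. B $$ (i, j) * x $ j\<bar>)"
    unfolding norm1_def using assms(1,2) by (intro sum.cong) (auto simp: mult_mat_vec_nth simp del: index_mult_mat_vec)
  also have "\<dots> \<le> (\<Sum>i<r. \<Sum>j<m. \<bar>B $$ (i, j)\<bar> * \<bar>x $ j\<bar>)"
    by (intro sum_mono order.trans[OF sum_abs]) (simp add: abs_mult)
  also have "\<dots> = (\<Sum>j<m. (\<Sum>i<r. \<bar>B $$ (i, j)\<bar>) * \<bar>x $ j\<bar>)"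
    unfolding sum_distrib_right by (rule sum.swap)
  also have "\<dots> \<le> (\<Sum>j<m. c * \<bar>x $ j\<bar>)"
    by (intro sum_mono mult_right_mono cols) auto
  also have "\<dots> = c * norm1 x" using assms(2) by (simp add: norm1_def sum_distrib_left)
  finally show ?thesis .
qed

lemma divide_le_of_le_mult:
  fixes a b c :: real
  assumes "a \<le> c * b" "b \<ge> 0" "c \<ge> 0"
  shows "a / b \<le> c"
  using assms by (cases "b = 0") (auto simp: pos_divide_le_eq)

text \<open>The operator norm is governed by the columns, and the second factor by exhibiting one
  cheap preimage for each image; no optimal preimage has to be identified.\<close>

lemma kappa_le:
  assumes B: "B \<in> carrier_mat r m" and "c \<ge> 0" "e \<ge> 0"
    and cols: "\<And>j. j < m \<Longrightarrow> (\<Sum>i<r. \<bar>B $$ (i, j)\<bar>) \<le> c"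
    and preimage: "\<And>x. x \<in> carrier_vec m \<Longrightarrow>
      \<exists>x' \<in> carrier_vec m. B *\<^sub>v x' = B *\<^sub>v x \<and> norm1 x' \<le> e * norm1 (B *\<^sub>v x)"
  shows "kappa B \<le> ennreal (c * e)"
proof -
  have dims: "dim_col B = m" "dim_row B = r" using B by auto
  have "opnorm1 B \<le> ennreal c"
    unfolding opnorm1_def dims using assms(2)
    by (intro SUP_least ennreal_leI divide_le_of_le_mult norm1_mult_le[OF B _ cols] norm1_nonneg) auto
  moreover have "(SUP g \<in> (\<lambda>x. B *\<^sub>v x) ` carrier_vec m - {0\<^sub>v r}.
      INF x \<in> {x \<in> carrier_vec m. B *\<^sub>v x = g}. ennreal (norm1 x / norm1 g)) \<le> ennreal e"
  proof (rule SUP_least)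
    fix g assume "g \<in> (\<lambda>x. B *\<^sub>v x) ` carrier_vec m - {0\<^sub>v r}"
    then obtain x where "x \<in> carrier_vec m" "g = B *\<^sub>v x" by blast
    then obtain x' where x': "x' \<in> carrier_vec m" "B *\<^sub>v x' = g" "norm1 x' \<le> e * norm1 g"
      using preimage by blast
    then show "(INF x \<in> {x \<in> carrier_vec m. B *\<^sub>v x = g}. ennreal (norm1 x / norm1 g)) \<le> ennreal e"
      using assms(3) by (intro INF_lower2[of x'] ennreal_leI divide_le_of_le_mult norm1_nonneg) auto
  qed
  ultimately have "kappa B \<le> ennreal c * ennreal e"
    unfolding kappa_def dims by (rule mult_mono) auto
  then show ?thesis using assms(2,3) by (simp add: ennreal_mult)
qed

text \<open>Linear independence concerns the set of columns, so equal columns are excluded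
  separately: they would put a difference of two unit vectors into the kernel.\<close>

lemma full_column_rankI:
  assumes P: "P \<in> carrier_mat r n"
    and inj: "\<And>x. x \<in> carrier_vec n \<Longrightarrow> P *\<^sub>v x = 0\<^sub>v r \<Longrightarrow> x = 0\<^sub>v n"
  shows "full_column_rank P"
proof -
  interpret V: vec_space "TYPE(real)" r .
  have "distinct (cols P)"
  proof (rule ccontr)
    assume "\<not> distinct (cols P)"
    then obtain i j where ij: "i < n" "j < n" "i \<noteq> j" "col P i = col P j"
      using P by (auto simp: distinct_conv_nth)
    define x :: "real vec" where "x = vec n (\<lambda>k. of_bool (k = i) - of_bool (k = j))"
    have x: "x \<in> carrier_vec n" by (simp add: x_def)
    have "P *\<^sub>v x = 0\<^sub>v r"
    proof (rule eq_vecI)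
      fix \<rho> assume "\<rho> < dim_vec (0\<^sub>v r :: real vec)"
      then have \<rho>: "\<rho> < r" by simp
      have "(P *\<^sub>v x) $ \<rho> = (\<Sum>k<n. P $$ (\<rho>, k) * of_bool (k = i)) - (\<Sum>k<n. P $$ (\<rho>, k) * of_bool (k = j))"
        unfolding mult_mat_vec_nth[OF P x \<rho>] sum_subtractf[symmetric]
        by (intro sum.cong) (auto simp: x_def right_diff_distrib)
      also have "\<dots> = P $$ (\<rho>, i) - P $$ (\<rho>, j)" using ij by (simp add: of_bool_def if_distrib cong: if_cong)
      also have "\<dots> = col P i $ \<rho> - col P j $ \<rho>" using P \<rho> ij(1,2) by simp
      also have "\<dots> = 0" using ij(4) by simp
      finally show "(P *\<^sub>v x) $ \<rho> = 0\<^sub>v r $ \<rho>" using \<rho> by simp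
    qed (use P in auto)
    then have "x = 0\<^sub>v n" using inj x by blast
    then have "x $ i = 0" using ij by simp
    then show False using ij by (simp add: x_def)
  qed
  moreover have "V.lin_indpt (set (cols P))"
    using V.lin_depE[OF P _ \<open>distinct (cols P)\<close>] inj by metis
  ultimately have "V.rank P = n" using V.lin_indpt_full_rank[OF P] by blast
  then show ?thesis using P by (simp add: full_column_rank_def)
qed

text \<open>\<open>mat_inverse\<close> is computed by elimination. Instead of following that
  computation, membership in the units shows that it succeeds, and uniqueness of inverses identifies
  the result.\<close>

lemma mat_inverse_mat_diag:
  fixes f :: "nat \<Rightarrow> real"
  assumes "\<And>i. i < m \<Longrightarrow> f i \<noteq> 0"
  shows "mat_inverse (mat_diag m f) = Some (mat_diag m (\<lambda>i. 1 / f i))"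
proof -
  let ?D = "mat_diag m f" and ?D' = "mat_diag m (\<lambda>i. 1 / f i)"
  have "mat_diag m (\<lambda>i. f i * (1 / f i)) = 1\<^sub>m m" "mat_diag m (\<lambda>i. 1 / f i * f i) = 1\<^sub>m m"
    using assms by (auto simp: mat_diag_def intro!: eq_matI)
  then have inv: "?D * ?D' = 1\<^sub>m m" "?D' * ?D = 1\<^sub>m m" by (simp_all only: mat_diag_diag)
  have "?D \<in> Units (ring_mat TYPE(real) m ())"
    unfolding Units_def ring_mat_def using inv
    by (auto simp del: mat_diag_diag intro!: bexI[of _ ?D'])
  then obtain C where C: "mat_inverse ?D = Some C"
    using mat_inverse(1)[OF mat_diag_dim[of m f], where b = "()"] by (cases "mat_inverse ?D") auto
  then have "C * ?D = 1\<^sub>m m" "C \<in> carrier_mat m m"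
    using mat_inverse(2)[OF mat_diag_dim] by auto
  note C_inv = this
  then have "C = C * (?D * ?D')" unfolding inv(1) by simp
  also have "\<dots> = C * ?D * ?D'"
    by (rule assoc_mult_mat[symmetric, OF C_inv(2) mat_diag_dim mat_diag_dim])
  also have "\<dots> = ?D'" unfolding C_inv(1) by (rule left_mult_one_mat[OF mat_diag_dim])
  finally show ?thesis using C by simp
qed

lemma (in weighted_graph) incidence_mult_weight_inverse:
  "incidence_mat n es * the (mat_inverse (weight_mat es w)) = mat n (length es) (\<lambda>(i, j). flow_entry es w i j)"
proof -
  have "real (w (es ! j)) \<noteq> 0" if "j < length es" for j
  proof -
    have "es ! j \<in> E" using that edges by auto
    then show ?thesis using edge_cases by (metis of_nat_0_eq_iff less_numeral_extra(3))
  qed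
  then have "the (mat_inverse (weight_mat es w)) = mat_diag (length es) (\<lambda>j. 1 / real (w (es ! j)))"
    unfolding weight_mat_def by (subst mat_inverse_mat_diag) auto
  moreover have "incidence_mat n es = mat n (length es) (\<lambda>(i, j). edge_sign (es ! j) i)"
    unfolding incidence_mat_def edge_sign_def by (rule refl)
  moreover have "mat n (length es) (\<lambda>(i, j). edge_sign (es ! j) i) \<in> carrier_mat n (length es)"
    by (rule mat_carrier)
  ultimately show ?thesis
    by (auto simp only: mat_diag_mult_right) (auto simp: flow_entry_def intro!: eq_matI)
qed

section \<open>The preconditioner\<close>

context vertex_grid
begin

definition precond :: "real mat" where
  "precond = mat (base ^ (d + 2)) n (\<lambda>(\<rho>, v). entry \<rho> v)"

lemma precond_carrier: "precond \<in> carrier_mat (base ^ (d + 2)) n"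
  by (simp add: precond_def)

lemma precond_nth: "\<rho> < base ^ (d + 2) \<Longrightarrow> v < n \<Longrightarrow> precond $$ (\<rho>, v) = entry \<rho> v"
  by (simp add: precond_def)

text \<open>The cells of level 0 are single points, so the rows \<open>grid_row 0 0 u\<close>
  already form an identity matrix up to order.\<close>

lemma precond_full_column_rank:
  assumes inj: "\<And>u v. u < n \<Longrightarrow> v < n \<Longrightarrow> (\<forall>k<d. \<phi> u k = \<phi> v k) \<Longrightarrow> u = v"
  shows "full_column_rank precond"
proof (rule full_column_rankI[OF precond_carrier])
  fix x :: "real vec" assume x: "x \<in> carrier_vec n" and zero: "precond *\<^sub>v x = 0\<^sub>v (base ^ (d + 2))"
  show "x = 0\<^sub>v n"
  proof (rule eq_vecI)
    fix u assume "u < dim_vec (0\<^sub>v n :: real vec)"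
    then have u: "u < n" by simp
    have \<rho>: "grid_row 0 0 u < base ^ (d + 2)" using u by (intro row_less) auto
    have "0 = (precond *\<^sub>v x) $ grid_row 0 0 u" using zero \<rho> by simp
    also have "\<dots> = (\<Sum>v<n. precond $$ (grid_row 0 0 u, v) * x $ v)"
      by (rule mult_mat_vec_nth[OF precond_carrier x \<rho>])
    also have "\<dots> = (\<Sum>v<n. if v = u then x $ v else 0)"
    proof (intro sum.cong refl)
      fix v assume "v \<in> {..<n}"
      then have v: "v < n" by simp
      have "same_cell 0 0 u v \<longleftrightarrow> u = v" using inj[OF u v] by (auto simp: same_cell_def)
      then show "precond $$ (grid_row 0 0 u, v) * x $ v = (if v = u then x $ v else 0)"
        using entry_row[of 0 0 u v] u v by (auto simp: precond_nth[OF \<rho> v])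
    qed
    finally show "x $ u = 0\<^sub>v n $ u" using u by simp
  qed (use x in simp)
qed

text \<open>Columns of the product are differences of two columns of \<open>precond\<close> divided
  by an edge weight, which \<open>upper\<close> controls. Preimages come from
  \<open>transport\<close>, whose unit routes are shortest paths and are priced by
  \<open>lower\<close>.\<close>

lemma kappa_precond_le:
  assumes "weighted_graph n E w es"
    and lower: "\<And>u v. u < n \<Longrightarrow> v < n \<Longrightarrow> real (graph_dist n E w u v) \<le> coord_dist d (\<phi> u) (\<phi> v)"
    and upper: "\<And>u v. u < n \<Longrightarrow> v < n \<Longrightarrow> coord_dist d (\<phi> u) (\<phi> v) \<le> \<alpha> * real (graph_dist n E w u v)"
    and "\<alpha> \<ge> 0"
    and inj: "\<And>u v. u < n \<Longrightarrow> v < n \<Longrightarrow> (\<forall>k<d. \<phi> u k = \<phi> v k) \<Longrightarrow> u = v"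
  shows "kappa (precond * incidence_mat n es * the (mat_inverse (weight_mat es w)))
    \<le> ennreal (4 * \<alpha> * (real l + 1) * real d)"
proof -
  interpret weighted_graph n E w es by fact
  let ?m = "length es" and ?R = "base ^ (d + 2)"
  define F where "F = mat n ?m (\<lambda>(i, j). flow_entry es w i j)"
  have F: "F \<in> carrier_mat n ?m" by (simp add: F_def)
  have F_nth: "F $$ (i, j) = flow_entry es w i j" if "i < n" "j < ?m" for i j
    using that by (simp add: F_def)
  have "the (mat_inverse (weight_mat es w)) \<in> carrier_mat ?m ?m"
  proof -
    have "real (w (es ! j)) \<noteq> 0" if "j < ?m" for j
      using that edges edge_cases by (metis nth_mem of_nat_0_eq_iff less_numeral_extra(3))
    then show ?thesis unfolding weight_mat_def by (subst mat_inverse_mat_diag) auto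
  qed
  then have eq: "precond * incidence_mat n es * the (mat_inverse (weight_mat es w)) = precond * F"
    unfolding F_def incidence_mult_weight_inverse[symmetric]
    by (intro assoc_mult_mat[OF precond_carrier]) (auto simp: incidence_mat_def)
  have B: "precond * F \<in> carrier_mat ?R ?m" using precond_carrier F by auto
  have "kappa (precond * F) \<le> ennreal ((2 * (real l + 1) * \<alpha>) * (2 * real d))"
  proof (rule kappa_le[OF B])
    fix j assume j: "j < ?m"
    then have "es ! j \<in> E" using edges by auto
    then obtain u v where e: "es ! j = {u, v}" "u \<noteq> v" "u < n" "v < n" "w (es ! j) > 0"
      by (metis edge_cases)
    define c where "c = (if u < v then 1 else -1) / real (w (es ! j))"
    have col: "\<bar>(precond * F) $$ (\<rho>, j)\<bar> = \<bar>entry \<rho> u - entry \<rho> v\<bar> / real (w (es ! j))" if \<rho>: "\<rho> < ?R" for \<rho>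
    proof -
      have "(precond * F) $$ (\<rho>, j) = (\<Sum>i<n. precond $$ (\<rho>, i) * F $$ (i, j))"
        using precond_carrier F \<rho> j by (auto simp: scalar_prod_def lessThan_atLeast0 intro!: sum.cong)
      also have "\<dots> = (\<Sum>i<n. c * (entry \<rho> i * of_bool (i = u) - entry \<rho> i * of_bool (i = v)))"
      proof (intro sum.cong refl)
        fix i assume "i \<in> {..<n}"
        then have i: "i < n" by simp
        have "F $$ (i, j) = c * (of_bool (i = u) - of_bool (i = v))"
          unfolding F_nth[OF i j] flow_entry_def c_def e(1) edge_sign_doubleton[OF e(2)] by simp
        then show "precond $$ (\<rho>, i) * F $$ (i, j) = c * (entry \<rho> i * of_bool (i = u) - entry \<rho> i * of_bool (i = v))"
          by (simp only: precond_nth[OF \<rho> i] right_diff_distrib mult.left_commute[of _ c])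
      qed
      also have "\<dots> = c * (entry \<rho> u - entry \<rho> v)"
        using e(3,4) unfolding sum_distrib_left[symmetric] sum_subtractf
        by (simp add: of_bool_def if_distrib cong: if_cong)
      finally show ?thesis by (simp add: abs_mult c_def)
    qed
    have "(\<Sum>\<rho><?R. \<bar>(precond * F) $$ (\<rho>, j)\<bar>) = (\<Sum>\<rho><?R. \<bar>entry \<rho> u - entry \<rho> v\<bar>) / real (w (es ! j))"
      by (simp add: col sum_divide_distrib del: index_mult_mat)
    also have "\<dots> \<le> (2 * (real l + 1) * coord_dist d (\<phi> u) (\<phi> v)) / real (w (es ! j))"
      by (intro divide_right_mono sum_entry_diff_le e) simp
    also have "\<dots> \<le> (2 * (real l + 1) * (\<alpha> * real (w (es ! j)))) / real (w (es ! j))"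
    proof (intro divide_right_mono mult_left_mono)
      have "{u, v} \<in> E" using \<open>es ! j \<in> E\<close> e(1) by simp
      \<comment> \<open>An edge is a walk, so its weight bounds the distance of its ends even if it
        is not a shortest path.\<close>
      then have "real (graph_dist n E w u v) \<le> real (w (es ! j))"
        using graph_dist_edge e by simp
      then show "coord_dist d (\<phi> u) (\<phi> v) \<le> \<alpha> * real (w (es ! j))"
        using upper[OF e(3,4)] mult_left_mono[OF _ \<open>\<alpha> \<ge> 0\<close>] by (rule_tac order.trans) auto
    qed auto
    also have "\<dots> = 2 * (real l + 1) * \<alpha>" using e(5) by simp
    finally show "(\<Sum>\<rho><?R. \<bar>(precond * F) $$ (\<rho>, j)\<bar>) \<le> 2 * (real l + 1) * \<alpha>" .
  next
    fix x :: "real vec" assume x: "x \<in> carrier_vec ?m"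
    define b where "b i = (F *\<^sub>v x) $ i" for i
    have b: "b i = (\<Sum>j<?m. flow_entry es w i j * x $ j)" if "i < n" for i
      unfolding b_def mult_mat_vec_nth[OF F x that] using that by (intro sum.cong) (auto simp: F_nth)
    have "(\<Sum>i<n. b i) = (\<Sum>j<?m. (\<Sum>i<n. flow_entry es w i j) * x $ j)"
      unfolding sum_distrib_right by (subst sum.swap) (simp add: b)
    also have "\<dots> = 0" by (simp add: sum_flow_entry)
    finally have balanced: "(\<Sum>i<n. b i) = 0" .
    have "\<exists>x. (\<forall>i<n. (\<Sum>j<?m. flow_entry es w i j * x j) = of_bool (i = u) - of_bool (i = v)) \<and>
      (\<Sum>j<?m. \<bar>x j\<bar>) \<le> coord_dist d (\<phi> u) (\<phi> v)" if "u < n" "v < n" for u v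
      using graph_dist_flow[OF that] lower[OF that] by (meson order.trans)
    from transport[OF inj balanced this] obtain y where
      y: "\<And>i. i < n \<Longrightarrow> (\<Sum>j<?m. flow_entry es w i j * y j) = b i"
        "(\<Sum>j<?m. \<bar>y j\<bar>) \<le> 2 * real d * (\<Sum>t\<le>l. \<Sum>r<2 ^ t. cell_norm b t r)"
      by blast
    define x' where "x' = vec ?m y"
    have x': "x' \<in> carrier_vec ?m" by (simp add: x'_def)
    have "F *\<^sub>v x' = F *\<^sub>v x"
    proof (rule eq_vecI)
      fix i assume "i < dim_vec (F *\<^sub>v x)"
      then have i: "i < n" using F by simp
      have "(F *\<^sub>v x') $ i = (\<Sum>j<?m. flow_entry es w i j * y j)"
        unfolding mult_mat_vec_nth[OF F x' i] using i by (intro sum.cong) (auto simp: F_nth x'_def)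
      then show "(F *\<^sub>v x') $ i = (F *\<^sub>v x) $ i" using y(1)[OF i] by (simp add: b_def)
    qed simp
    then have "(precond * F) *\<^sub>v x' = (precond * F) *\<^sub>v x"
      using assoc_mult_mat_vec[OF precond_carrier F] x x' by simp
    moreover have norm_eq: "norm1 ((precond * F) *\<^sub>v x) = (\<Sum>\<rho><?R. \<bar>\<Sum>v<n. entry \<rho> v * b v\<bar>)"
    proof -
      have Fx: "F *\<^sub>v x \<in> carrier_vec n" using F x by simp
      have "norm1 (precond *\<^sub>v (F *\<^sub>v x)) = (\<Sum>\<rho><?R. \<bar>(precond *\<^sub>v (F *\<^sub>v x)) $ \<rho>\<bar>)"
        using precond_carrier by (simp add: norm1_def del: index_mult_mat_vec)
      also have "\<dots> = (\<Sum>\<rho><?R. \<bar>\<Sum>v<n. entry \<rho> v * b v\<bar>)"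
        by (intro sum.cong refl arg_cong[where f = abs])
          (auto simp: mult_mat_vec_nth[OF precond_carrier Fx] b_def precond_nth simp del: index_mult_mat_vec intro!: sum.cong)
      finally show ?thesis using assoc_mult_mat_vec[OF precond_carrier F x] by simp
    qed
    moreover have "norm1 x' \<le> 2 * real d * norm1 ((precond * F) *\<^sub>v x)"
    proof -
      have "norm1 x' = (\<Sum>j<?m. \<bar>y j\<bar>)" by (simp add: norm1_def x'_def)
      also note y(2)
      also have "2 * real d * (\<Sum>t\<le>l. \<Sum>r<2 ^ t. cell_norm b t r) \<le> 2 * real d * norm1 ((precond * F) *\<^sub>v x)"
        unfolding norm_eq by (intro mult_left_mono cell_norm_le_norm) simp
      finally show ?thesis .
    qed
    ultimately show "\<exists>x'\<in>carrier_vec ?m. (precond * F) *\<^sub>v x' = (precond * F) *\<^sub>v x \<and>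
        norm1 x' \<le> 2 * real d * norm1 ((precond * F) *\<^sub>v x)"
      using x' by blast
  qed (use \<open>\<alpha> \<ge> 0\<close> in auto)
  also have "2 * (real l + 1) * \<alpha> * (2 * real d) = 4 * \<alpha> * (real l + 1) * real d" by simp
  finally show ?thesis unfolding eq .
qed

end

section \<open>Bounded execution\<close>

lemma len_le_iff: "0 \<le> z \<Longrightarrow> len z \<le> Suc e \<longleftrightarrow> z < 2 ^ e"
  by (simp add: len_def nat_le_iff bitlen_le_iff_power)

lemma len_mono:
  assumes "a \<le> b" shows "len (int a) \<le> len (int b)"
proof -
  obtain e where e: "len (int b) = Suc e" by (simp add: len_def)
  then have "int b < 2 ^ e" using len_le_iff[of "int b" e] by simp
  then have "int a < 2 ^ e" using assms by linarith
  then show ?thesis using len_le_iff[of "int a" e] e by simp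
qed

lemma len_pos: "1 \<le> len z"
  by (simp add: len_def)

text \<open>Counts the charges of one evaluation. Each is at most the squared length of the largest
  number involved; the square is dictated by multiplication and division.\<close>

primrec asize :: "aexp \<Rightarrow> nat" where
  "asize (Num k) = 1"
| "asize (Reg x) = 1"
| "asize (Arr a e) = asize e + 2"
| "asize (Plus e f) = asize e + asize f + 2"
| "asize (Minus e f) = asize e + asize f + 2"
| "asize (Times e f) = asize e + asize f + 2"
| "asize (Divide e f) = asize e + asize f + 2"
| "asize (Modulo e f) = asize e + asize f + 2"

primrec bsize :: "bexp \<Rightarrow> nat" where
  "bsize (Less e f) = asize e + asize f + 2"
| "bsize (Neg b) = bsize b + 1"
| "bsize (Conj b c) = bsize b + bsize c + 1"

text \<open>An evaluation within the naturals up to \<open>N\<close>: the bound on the value lets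
  all costs be charged uniformly, and subtraction has to be shown not to underflow.\<close>

definition nval :: "nat \<Rightarrow> aexp \<Rightarrow> state \<Rightarrow> nat \<Rightarrow> bool" where
  "nval N e s a \<longleftrightarrow> aval e s = int a \<and> a \<le> N \<and> acost e s \<le> asize e * (len (int N))\<^sup>2"

definition bev :: "nat \<Rightarrow> bexp \<Rightarrow> state \<Rightarrow> bool \<Rightarrow> bool" where
  "bev N b s v \<longleftrightarrow> bval b s = v \<and> bcost b s \<le> bsize b * (len (int N))\<^sup>2"

text \<open>Total correctness with time measured in units of the squared length of \<open>N\<close>,
  which separates counting operations from the logarithmic cost.\<close>

definition runs :: "nat \<Rightarrow> com \<Rightarrow> state \<Rightarrow> nat \<Rightarrow> (state \<Rightarrow> bool) \<Rightarrow> bool" where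
  "runs N c s K Q \<longleftrightarrow> (\<exists>t s'. exec c s t s' \<and> t \<le> K * (len (int N))\<^sup>2 \<and> Q s')"

lemma len_le_square: "a \<le> N \<Longrightarrow> len (int a) \<le> (len (int N))\<^sup>2"
  using len_mono[of a N] len_pos[of "int N"] by (simp add: power2_eq_square) (meson le_trans le_square)

lemma len_mult_le_square: "a \<le> N \<Longrightarrow> b \<le> N \<Longrightarrow> len (int a) * len (int b) \<le> (len (int N))\<^sup>2"
  using len_mono[of a N] len_mono[of b N] by (simp add: power2_eq_square mult_mono)

lemma one_le_len_square: "1 \<le> (len (int N))\<^sup>2"
  using len_pos[of "int N"] by simp

lemma nval_Num: "k \<le> N \<Longrightarrow> nval N (Num (int k)) s k"
  using len_le_square[of k N] by (simp add: nval_def)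

lemma nval_Num_0: "nval N (Num 0) s 0"
  using nval_Num[of 0] by simp

lemma nval_Num_1: "1 \<le> N \<Longrightarrow> nval N (Num 1) s 1"
  using nval_Num[of 1] by simp

lemma nval_Num_2: "2 \<le> N \<Longrightarrow> nval N (Num 2) s 2"
  using nval_Num[of 2] by simp

lemma nval_Reg: "regs s x = int a \<Longrightarrow> a \<le> N \<Longrightarrow> nval N (Reg x) s a"
  using len_le_square[of a N] by (simp add: nval_def)

lemma nval_Arr:
  "nval N e s i \<Longrightarrow> arrs s A (int i) = int a \<Longrightarrow> a \<le> N \<Longrightarrow> nval N (Arr A e) s a"
  using len_le_square[of a N] len_le_square[of i N] by (simp add: nval_def algebra_simps)

lemma nval_Plus:
  "nval N e s a \<Longrightarrow> nval N f s b \<Longrightarrow> a + b \<le> N \<Longrightarrow> nval N (Plus e f) s (a + b)"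
  using len_le_square[of a N] len_le_square[of b N] by (simp add: nval_def algebra_simps)

lemma nval_Minus:
  "nval N e s a \<Longrightarrow> nval N f s b \<Longrightarrow> b \<le> a \<Longrightarrow> nval N (Minus e f) s (a - b)"
  using len_le_square[of a N] len_le_square[of b N]
  by (auto simp: nval_def algebra_simps of_nat_diff intro: le_trans[OF diff_le_self])

lemma nval_Times:
  "nval N e s a \<Longrightarrow> nval N f s b \<Longrightarrow> a * b \<le> N \<Longrightarrow> nval N (Times e f) s (a * b)"
  using len_mult_le_square[of a N b] by (simp add: nval_def algebra_simps)

lemma nval_Divide:
  "nval N e s a \<Longrightarrow> nval N f s b \<Longrightarrow> nval N (Divide e f) s (a div b)"
  using len_mult_le_square[of a N b] div_le_dividend[of a b] le_trans[of "a div b" a N]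
  by (simp add: nval_def algebra_simps zdiv_int)

lemma nval_Modulo:
  "nval N e s a \<Longrightarrow> nval N f s b \<Longrightarrow> nval N (Modulo e f) s (a mod b)"
  using len_mult_le_square[of a N b] mod_less_eq_dividend[of a b] le_trans[of "a mod b" a N]
  by (simp add: nval_def algebra_simps zmod_int)

lemmas nval_intros = nval_Num_0 nval_Num_1 nval_Num_2 nval_Reg nval_Arr nval_Plus nval_Minus
  nval_Times nval_Divide nval_Modulo

lemma bev_Less: "nval N e s a \<Longrightarrow> nval N f s b \<Longrightarrow> bev N (Less e f) s (a < b)"
  using len_le_square[of a N] len_le_square[of b N] by (simp add: nval_def bev_def algebra_simps)

lemma bev_Neg: "bev N b s v \<Longrightarrow> bev N (Neg b) s (\<not> v)"
  using one_le_len_square[of N] by (simp add: bev_def)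

lemma runs_mono: "runs N c s K Q \<Longrightarrow> K \<le> K' \<Longrightarrow> (\<And>s'. Q s' \<Longrightarrow> Q' s') \<Longrightarrow> runs N c s K' Q'"
  unfolding runs_def by (meson le_trans mult_le_mono1)

lemma runs_Skip: "Q s \<Longrightarrow> runs N Skip s 1 Q"
  unfolding runs_def using exec.Skip[of s] one_le_len_square[of N] by fastforce

lemma runs_Assign:
  assumes "nval N e s a" "Q (s\<lparr>regs := (regs s)(x := int a)\<rparr>)"
  shows "runs N (Assign x e) s (asize e + 1) Q"
  using exec.Assign[of x e s] assms len_le_square[of a N]
  unfolding runs_def nval_def by (fastforce simp: algebra_simps)

lemma runs_Store:
  assumes "nval N i s k" "nval N e s a"
    "Q (s\<lparr>arrs := (arrs s)(A := (arrs s A)(int k := int a))\<rparr>)"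
  shows "runs N (Store A i e) s (asize i + asize e + 2) Q"
proof -
  have "acost i s + acost e s + len (aval i s) + len (aval e s) \<le> (asize i + asize e + 2) * (len (int N))\<^sup>2"
    using assms len_le_square[of a N] len_le_square[of k N] by (simp add: nval_def algebra_simps)
  moreover have "exec (Store A i e) s (acost i s + acost e s + len (aval i s) + len (aval e s))
     (s\<lparr>arrs := (arrs s)(A := (arrs s A)(int k := int a))\<rparr>)"
    using exec.Store[of A i e s] assms by (simp add: nval_def)
  ultimately show ?thesis using assms(3) unfolding runs_def by blast
qed

lemma runs_Seq:
  assumes "runs N c s K (\<lambda>s'. runs N c' s' K' Q)"
  shows "runs N (Seq c c') s (K + K') Q"
  using assms unfolding runs_def by (force intro: exec.Seq simp: algebra_simps)

lemma runs_Cond: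
  assumes "bev N b s v" "v \<Longrightarrow> runs N c s K Q" "\<not> v \<Longrightarrow> runs N c' s K Q"
  shows "runs N (Cond b c c') s (bsize b + 1 + K) Q"
proof -
  obtain t s' where r: "exec (if v then c else c') s t s'" "t \<le> K * (len (int N))\<^sup>2" "Q s'"
    using assms(2,3) unfolding runs_def by (cases v) auto
  have "exec (Cond b c c') s (bcost b s + 1 + t) s'"
    using r(1) assms(1) exec.CondTrue[of b s c t s' c'] exec.CondFalse[of b s c' t s' c]
    by (cases v) (auto simp: bev_def)
  moreover have "bcost b s + 1 + t \<le> (bsize b + 1 + K) * (len (int N))\<^sup>2"
    using assms(1) r(2) one_le_len_square[of N] by (simp add: bev_def algebra_simps)
  ultimately show ?thesis using r(3) unfolding runs_def by blast
qed

text \<open>Meant for loop-free code: \<open>While\<close> gets a dummy value, and loops are charged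
  by \<open>runs_While\<close>. Adding both branches of a conditional avoids a maximum.\<close>

primrec csize :: "com \<Rightarrow> nat" where
  "csize Skip = 1"
| "csize (Assign x e) = asize e + 1"
| "csize (Store A i e) = asize i + asize e + 2"
| "csize (Seq c c') = csize c + csize c'"
| "csize (Cond b c c') = bsize b + 1 + (csize c + csize c')"
| "csize (While b c) = 0"

lemma straight_Skip: "Q s \<Longrightarrow> runs N Skip s (csize Skip) Q"
  using runs_Skip by simp

lemma straight_Assign:
  "nval N e s a \<Longrightarrow> Q (s\<lparr>regs := (regs s)(x := int a)\<rparr>) \<Longrightarrow> runs N (Assign x e) s (csize (Assign x e)) Q"
  using runs_Assign[of N e s a Q x] by simp

lemma straight_Store:
  "nval N i s k \<Longrightarrow> nval N e s a \<Longrightarrow> Q (s\<lparr>arrs := (arrs s)(A := (arrs s A)(int k := int a))\<rparr>) \<Longrightarrow>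
   runs N (Store A i e) s (csize (Store A i e)) Q"
  using runs_Store[of N i s k e a Q A] by simp

lemma straight_Seq:
  assumes "runs N c s (csize c) Q1" "\<And>s'. Q1 s' \<Longrightarrow> runs N c' s' (csize c') Q"
  shows "runs N (Seq c c') s (csize (Seq c c')) Q"
  using runs_Seq[OF runs_mono[OF assms(1) le_refl assms(2)]] by simp

lemma straight_Seq_direct:
  "runs N c s (csize c) (\<lambda>s'. runs N c' s' (csize c') Q) \<Longrightarrow> runs N (Seq c c') s (csize (Seq c c')) Q"
  by (rule straight_Seq)

lemma straight_Cond:
  assumes "bev N b s v" "v \<Longrightarrow> runs N c s (csize c) Q" "\<not> v \<Longrightarrow> runs N c' s (csize c') Q"
  shows "runs N (Cond b c c') s (csize (Cond b c c')) Q"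
  unfolding csize.simps using assms by (intro runs_Cond[of N b s v]) (auto intro: runs_mono)

text \<open>Indexing the invariant by the number of completed rounds makes the exact count
  \<open>m\<close> both the termination argument and the time bound; the last summand pays for the
  final test.\<close>

lemma runs_While:
  assumes step: "\<And>i s. i < m \<Longrightarrow> I i s \<Longrightarrow> bev N b s True \<and> runs N c s K (I (Suc i))"
    and stop: "\<And>s. I m s \<Longrightarrow> bev N b s False"
    and start: "I 0 s"
  shows "runs N (While b c) s (m * (bsize b + 1 + K) + (bsize b + 1)) (I m)"
proof -
  have "runs N (While b c) s (k * (bsize b + 1 + K) + (bsize b + 1)) (I m)"
    if "k \<le> m" "I (m - k) s" for k s
    using that
  proof (induction k arbitrary: s)
    case 0
    then have "bev N b s False" using stop by simp
    then have "exec (While b c) s (bcost b s + 1) s" "bcost b s + 1 \<le> (bsize b + 1) * (len (int N))\<^sup>2"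
      using exec.WhileFalse one_le_len_square[of N] by (auto simp: bev_def)
    then show ?case using 0 unfolding runs_def by auto
  next
    case (Suc k)
    have *: "bev N b s True" "runs N c s K (I (m - k))"
      using step[of "m - Suc k" s] Suc.prems by (auto simp: Suc_diff_Suc)
    then obtain t s' where r: "exec c s t s'" "t \<le> K * (len (int N))\<^sup>2" "I (m - k) s'"
      unfolding runs_def by blast
    from Suc.IH[OF _ r(3)] Suc.prems obtain t' s'' where r': "exec (While b c) s' t' s''"
        "t' \<le> (k * (bsize b + 1 + K) + (bsize b + 1)) * (len (int N))\<^sup>2" "I m s''"
      unfolding runs_def by auto
    have "exec (While b c) s (bcost b s + 1 + t + t') s''"
      using * r(1) r'(1) exec.WhileTrue[of b s c t s' t' s''] by (auto simp: bev_def)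
    moreover have "bcost b s + 1 + t + t' \<le> (Suc k * (bsize b + 1 + K) + (bsize b + 1)) * (len (int N))\<^sup>2"
      using * r(2) r'(2) one_le_len_square[of N] by (simp add: bev_def algebra_simps)
    ultimately show ?case using r'(3) unfolding runs_def by blast
  qed
  from this[of m s] start show ?thesis by simp
qed

text \<open>Absorbs the additive overhead of a loop into the product of the loop lengths. With
  \<open>c = 20\<close> each nesting level adds 40, hence the constants 300, 340, 380 and 420
  below.\<close>

lemma loop_cost_le:
  fixes D x a c :: nat
  assumes "1 \<le> D" "1 \<le> x"
  shows "D * (c + a * x) + c \<le> (2 * c + a) * (D * x)"
proof -
  have D: "D * 1 \<le> D * x" "1 * 1 \<le> D * x" using assms by (intro mult_le_mono; simp)+
  have "D * (c + a * x) + c = c * (D * 1) + c * (1 * 1) + a * (D * x)" by (simp add: algebra_simps)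
  also have "\<dots> \<le> c * (D * x) + c * (D * x) + a * (D * x)"
    by (intro add_mono mult_le_mono2 D le_refl)
  also have "\<dots> = (2 * c + a) * (D * x)" by (simp add: algebra_simps)
  finally show ?thesis .
qed

section \<open>The program\<close>

definition base_expr :: aexp where
  "base_expr = Times (Num 2) (Reg ''Delta'')"

definition shifted_coord :: aexp where
  "shifted_coord = Plus (Arr ''phi'' (Plus (Times (Reg ''v'') (Reg ''d'')) (Reg ''k''))) (Reg ''s'')"

definition gap_expr :: aexp where
  "gap_expr = Minus (Reg ''T'') (Modulo shifted_coord (Reg ''T''))"

text \<open>Advances the recursions \<open>cell_code\<close> and \<open>run_length\<close> together
  by one coordinate.\<close>

definition coord_step :: com where
  "coord_step =
     Seq (Assign ''code'' (Plus (Times (Reg ''code'') base_expr) (Divide shifted_coord (Reg ''T''))))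
    (Seq (Cond (Less gap_expr (Reg ''gap'')) (Assign ''gap'' gap_expr) Skip)
         (Assign ''k'' (Plus (Reg ''k'') (Num 1))))"

definition run_init :: com where
  "run_init =
     Seq (Cond (Less (Reg ''j'') (Reg ''d''))
           (Assign ''s'' (Modulo (Minus (Reg ''T'')
              (Modulo (Arr ''phi'' (Plus (Times (Reg ''v'') (Reg ''d'')) (Reg ''j''))) (Reg ''T''))) (Reg ''T'')))
           (Assign ''s'' (Num 0)))
    (Seq (Assign ''code'' (Reg ''T''))
    (Seq (Assign ''gap'' (Minus (Reg ''T'') (Reg ''s'')))
         (Assign ''k'' (Num 0))))"

definition run_emit :: com where
  "run_emit =
     Seq (Assign ''code'' (Plus (Times (Reg ''code'') base_expr) (Reg ''s'')))
    (Seq (Store ''lo'' (Reg ''p'') (Reg ''code''))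
    (Seq (Store ''hi'' (Reg ''p'') (Minus (Plus (Reg ''code'') (Reg ''gap'')) (Num 1)))
    (Seq (Store ''num'' (Reg ''p'') (Num 1))
    (Seq (Store ''den'' (Reg ''p'') (Num 1))
    (Seq (Store ''size'' (Reg ''v'') (Plus (Arr ''size'' (Reg ''v'')) (Num 1)))
    (Seq (Assign ''p'' (Plus (Reg ''p'') (Num 1)))
         (Assign ''j'' (Plus (Reg ''j'') (Num 1)))))))))"

definition run_step :: com where
  "run_step = Seq run_init (Seq (While (Less (Reg ''k'') (Reg ''d'')) coord_step) run_emit)"

text \<open>The guard admits \<open>j = d\<close>, the index of the run that starts at shift
  0.\<close>

definition level_step :: com where
  "level_step =
     Seq (Assign ''j'' (Num 0))
    (Seq (While (Neg (Less (Reg ''d'') (Reg ''j''))) run_step)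
         (Assign ''T'' (Times (Num 2) (Reg ''T''))))"

text \<open>Doubling \<open>T\<close> until it exceeds \<open>Delta\<close> visits the levels 0 to
  \<open>l\<close> without computing a logarithm.\<close>

definition vertex_step :: com where
  "vertex_step =
     Seq (Assign ''T'' (Num 1))
    (Seq (While (Neg (Less (Reg ''Delta'') (Reg ''T''))) level_step)
         (Assign ''v'' (Plus (Reg ''v'') (Num 1))))"

definition embedding_prog :: com where
  "embedding_prog = While (Less (Reg ''v'') (Reg ''n'')) vertex_step"

text \<open>The arrays \<open>lo\<close> and \<open>hi\<close> hold 0 from the start, so this emits
  the interval \<open>[0, 0]\<close> with value 1, the identity matrix of size one.\<close>

definition single_prog :: com where
  "single_prog = Seq (Store ''size'' (Num 0) (Num 1))
    (Seq (Store ''num'' (Num 0) (Num 1)) (Store ''den'' (Num 0) (Num 1)))"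

text \<open>For \<open>n = 1\<close> or \<open>d = 0\<close> the argument of the polynomial is 0 and
  the time limit is a constant times \<open>n\<close>, which does not cover the length of
  \<open>Delta\<close>. Both cases branch off before \<open>Delta\<close> is read.\<close>

definition main_prog :: com where
  "main_prog = Cond (Less (Reg ''n'') (Num 2)) single_prog
     (Cond (Less (Reg ''d'') (Num 1)) Skip embedding_prog)"

section \<open>Loop invariants and number bounds\<close>

context vertex_grid
begin

definition pos :: "nat \<Rightarrow> nat \<Rightarrow> nat \<Rightarrow> nat" where
  "pos v t j = (v * Suc l + t) * Suc d + j"

definition start :: "nat \<Rightarrow> nat \<Rightarrow> nat \<Rightarrow> nat" where
  "start v t j = run_start d (2 ^ t) (\<phi> v) j"

definition lo :: "nat \<Rightarrow> nat \<Rightarrow> nat \<Rightarrow> nat" where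
  "lo v t j = row_index base d (2 ^ t) (\<phi> v) (start v t j)"

definition hi :: "nat \<Rightarrow> nat \<Rightarrow> nat \<Rightarrow> nat" where
  "hi v t j = lo v t j + run_length (2 ^ t) (\<phi> v) (start v t j) d - 1"

text \<open>Decodes an output position into vertex, level and run, so that one quantifier describes
  everything written so far.\<close>

definition at_pos :: "(nat \<Rightarrow> nat \<Rightarrow> nat \<Rightarrow> nat) \<Rightarrow> nat \<Rightarrow> nat" where
  "at_pos f q = f (q div Suc d div Suc l) (q div Suc d mod Suc l) (q mod Suc d)"

text \<open>A common bound for all numbers and addresses of the main loop: output positions stay
  below the first summand, row indices below the second.\<close>

definition bound :: nat where
  "bound = n * Suc l * Suc d + base ^ (d + 2)"

text \<open>Common to all loops, with \<open>v\<close>, \<open>t\<close>, \<open>j\<close> as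
  progress; the \<open>inv_\<close> predicates add the registers that are live at each depth.
  Entries of \<open>size\<close> beyond \<open>v\<close> are kept at 0 because the program only ever
  increments them.\<close>

definition loop_inv :: "nat \<Rightarrow> nat \<Rightarrow> nat \<Rightarrow> state \<Rightarrow> bool" where
  "loop_inv v t j s \<longleftrightarrow> regs s ''n'' = int n \<and> regs s ''d'' = int d \<and> regs s ''Delta'' = int (2 ^ l) \<and>
     regs s ''v'' = int v \<and> regs s ''p'' = int (pos v t j) \<and>
     (\<forall>u<n. \<forall>k<d. arrs s ''phi'' (int (u * d + k)) = int (\<phi> u k)) \<and>
     (\<forall>i. arrs s ''size'' (int i) =
        int (if i < v then Suc l * Suc d else if i = v then t * Suc d + j else 0)) \<and>
     (\<forall>q<pos v t j. arrs s ''lo'' (int q) = int (at_pos lo q) \<and> arrs s ''hi'' (int q) = int (at_pos hi q) \<and>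
        arrs s ''num'' (int q) = 1 \<and> arrs s ''den'' (int q) = 1)"

definition inv_T :: "nat \<Rightarrow> nat \<Rightarrow> nat \<Rightarrow> state \<Rightarrow> bool" where
  "inv_T v t j s \<longleftrightarrow> loop_inv v t j s \<and> regs s ''T'' = int (2 ^ t)"

definition inv_j :: "nat \<Rightarrow> nat \<Rightarrow> nat \<Rightarrow> state \<Rightarrow> bool" where
  "inv_j v t j s \<longleftrightarrow> inv_T v t j s \<and> regs s ''j'' = int j"

definition inv_s :: "nat \<Rightarrow> nat \<Rightarrow> nat \<Rightarrow> nat \<Rightarrow> state \<Rightarrow> bool" where
  "inv_s v t j k s \<longleftrightarrow> inv_j v t j s \<and> regs s ''s'' = int (start v t j) \<and> regs s ''k'' = int k"

definition inv_k :: "nat \<Rightarrow> nat \<Rightarrow> nat \<Rightarrow> nat \<Rightarrow> state \<Rightarrow> bool" where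
  "inv_k v t j k s \<longleftrightarrow> inv_s v t j k s \<and>
     regs s ''code'' = int (cell_code base (2 ^ t) (\<phi> v) (start v t j) k) \<and>
     regs s ''gap'' = int (run_length (2 ^ t) (\<phi> v) (start v t j) k)"

lemma at_pos_pos: "t \<le> l \<Longrightarrow> j \<le> d \<Longrightarrow> at_pos f (pos v t j) = f v t j"
  by (simp add: at_pos_def pos_def div_mult_self3 del: mult_Suc_right)

lemma pos_less:
  assumes "v < n" "t \<le> l" "j \<le> d" shows "pos v t j < n * Suc l * Suc d"
proof -
  have "v * Suc l + t < n * Suc l"
    using assms(1,2) mult_le_mono1[of "Suc v" n "Suc l"] by simp
  then show ?thesis unfolding pos_def
    using assms(3) mult_le_mono1[of "Suc (v * Suc l + t)" "n * Suc l" "Suc d"] by simp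
qed

lemma base_le: "base ^ Suc k \<le> bound" if "k \<le> Suc d"
proof -
  have "base ^ Suc k \<le> base ^ (d + 2)" using that by (intro power_increasing) (auto simp: base_def)
  then show ?thesis unfolding bound_def by linarith
qed

lemma base_le_bound: "2 * 2 ^ l \<le> bound"
  using base_le[of 0] by (simp add: base_def)

lemma two_le_bound: "2 \<le> bound"
proof -
  have "1 \<le> (2::nat) ^ l" by simp
  then show ?thesis using base_le_bound by linarith
qed

lemma start_less: "start v t j < 2 ^ t"
  by (simp add: start_def run_start_less)

lemma shifted_le:
  assumes "v < n" "k < d" "t \<le> l"
  shows "\<phi> v k + start v t j < base"
  using coord_range[OF assms(1,2)] start_less[of v t j] pow_le[OF assms(3)]
  unfolding base_def by (auto simp del: power_increasing_iff)

lemma digit_less: "v < n \<Longrightarrow> k < d \<Longrightarrow> t \<le> l \<Longrightarrow> (\<phi> v k + start v t j) div 2 ^ t < base"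
  using shifted_le div_le_dividend le_less_trans by blast

lemma code_less:
  assumes "v < n" "k \<le> d" "t \<le> l"
  shows "cell_code base (2 ^ t) (\<phi> v) (start v t j) k < base ^ Suc k"
proof (rule cell_code_less)
  show "2 ^ t < base" using pow_le[OF assms(3)] zero_less_power[of "2::nat" l] unfolding base_def by linarith
qed (use assms digit_less in auto)

lemma phi_index_le:
  assumes "v < n" "k \<le> d" shows "v * d + k \<le> bound"
proof -
  have "v * d + k \<le> n * d" using mult_le_mono1[of "Suc v" n d] assms by simp
  also have "\<dots> \<le> n * Suc l * Suc d" by (intro mult_le_mono) auto
  finally show ?thesis unfolding bound_def by linarith
qed

lemma n_le_bound: "n \<le> bound"
  by (simp add: bound_def)

lemma pow_le_bound: "t \<le> Suc l \<Longrightarrow> 2 ^ t \<le> bound"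
  using power_increasing[of t "Suc l" "2::nat"] base_le_bound by simp

lemma d_le_bound: "Suc d \<le> bound"
proof -
  have "Suc d \<le> 2 ^ Suc d" by (rule less_imp_le_nat[OF less_exp])
  also have "\<dots> \<le> base ^ Suc d" by (intro power_mono) (auto simp: base_def)
  also have "\<dots> \<le> bound" by (rule base_le) simp
  finally show ?thesis .
qed

lemma shifted_coord_nval:
  assumes "inv_s v t j k s" "v < n" "t \<le> l" "k < d"
  shows "nval bound shifted_coord s (\<phi> v k + start v t j)"
  unfolding shifted_coord_def
proof (intro nval_Plus nval_Times nval_Reg nval_Arr[where i = "v * d + k"])
  show "regs s ''v'' = int v" "regs s ''d'' = int d" "regs s ''k'' = int k" "regs s ''s'' = int (start v t j)"
    "arrs s ''phi'' (int (v * d + k)) = int (\<phi> v k)"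
    using assms unfolding inv_s_def inv_j_def inv_T_def loop_inv_def by blast+
  show "\<phi> v k + start v t j \<le> bound" "\<phi> v k \<le> bound" "start v t j \<le> bound"
    using shifted_le[OF assms(2,4,3), of j] base_le_bound unfolding base_def by linarith+
  show "v * d + k \<le> bound" "v * d \<le> bound" "v \<le> bound" "d \<le> bound" "k \<le> bound"
    using phi_index_le[OF assms(2), of k] assms(2,4) n_le_bound d_le_bound by linarith+
qed

lemma gap_expr_nval:
  assumes "inv_s v t j k s" "v < n" "t \<le> l" "k < d"
  shows "nval bound gap_expr s (2 ^ t - (\<phi> v k + start v t j) mod 2 ^ t)"
  unfolding gap_expr_def
proof (intro nval_Minus nval_Modulo nval_Reg shifted_coord_nval[OF assms])
  show "regs s ''T'' = int (2 ^ t)" "regs s ''T'' = int (2 ^ t)"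
    using assms unfolding inv_s_def inv_j_def inv_T_def by blast+
qed (use assms(3) pow_le_bound in auto)

lemma base_expr_nval:
  assumes "loop_inv v t j s"
  shows "nval bound base_expr s base"
  unfolding base_expr_def base_def
  by (intro nval_Times nval_Num_2 nval_Reg)
    (use assms base_le_bound two_le_bound pow_le_bound[of l] in \<open>auto simp: loop_inv_def\<close>)


lemma inv_s_update [simp]:
  "inv_s v t j k (s\<lparr>regs := (regs s)(''code'' := z)\<rparr>) = inv_s v t j k s"
  "inv_s v t j k (s\<lparr>regs := (regs s)(''gap'' := z)\<rparr>) = inv_s v t j k s"
  by (simp_all add: inv_s_def inv_j_def inv_T_def loop_inv_def)

lemma inv_s_loop_inv: "inv_s v t j k s \<Longrightarrow> loop_inv v t j s"
  by (simp add: inv_s_def inv_j_def inv_T_def)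

lemma inv_s_T: "inv_s v t j k s \<Longrightarrow> regs s ''T'' = int (2 ^ t)"
  by (simp add: inv_s_def inv_j_def inv_T_def)

lemma code_le:
  assumes "v < n" "k \<le> d" "t \<le> l"
  shows "cell_code base (2 ^ t) (\<phi> v) (start v t j) k \<le> bound"
  using code_less[OF assms, of j] base_le[of k] assms(2) by linarith

lemma coord_step_runs:
  assumes inv: "inv_k v t j k s" and le: "v < n" "t \<le> l" "k < d"
  shows "runs bound coord_step s (csize coord_step) (inv_k v t j (Suc k))"
  unfolding coord_step_def
proof (rule straight_Seq)
  let ?c = "cell_code base (2 ^ t) (\<phi> v) (start v t j)"
  let ?g = "run_length (2 ^ t) (\<phi> v) (start v t j)"
  let ?Q1 = "\<lambda>s. inv_s v t j k s \<and> regs s ''code'' = int (?c (Suc k)) \<and> regs s ''gap'' = int (?g k)"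
  let ?Q2 = "\<lambda>s. inv_s v t j k s \<and> regs s ''code'' = int (?c (Suc k)) \<and> regs s ''gap'' = int (?g (Suc k))"
  have s: "inv_s v t j k s" "regs s ''code'' = int (?c k)" "regs s ''gap'' = int (?g k)"
    using inv by (auto simp: inv_k_def)
  show "runs bound (Assign ''code'' (Plus (Times (Reg ''code'') base_expr) (Divide shifted_coord (Reg ''T'')))) s
     (csize (Assign ''code'' (Plus (Times (Reg ''code'') base_expr) (Divide shifted_coord (Reg ''T''))))) ?Q1"
  proof (rule straight_Assign)
    have b: "?c k * base + (\<phi> v k + start v t j) div 2 ^ t \<le> bound"
      using code_le[OF le(1) _ le(2), of "Suc k" j] le(3) by simp
    show "nval bound (Plus (Times (Reg ''code'') base_expr) (Divide shifted_coord (Reg ''T''))) s (?c (Suc k))"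
      unfolding cell_code.simps
      using code_le[OF le(1) _ le(2), of k j] le(2,3) b pow_le_bound[of t]
      by (intro nval_Plus nval_Times nval_Divide nval_Reg base_expr_nval[OF inv_s_loop_inv[OF s(1)]]
          shifted_coord_nval[OF s(1) le] inv_s_T[OF s(1)] s(2)) linarith+
    show "?Q1 (s\<lparr>regs := (regs s)(''code'' := int (?c (Suc k)))\<rparr>)" using s by simp
  qed
  fix s1 assume s1: "?Q1 s1"
  show "runs bound (Seq (Cond (Less gap_expr (Reg ''gap'')) (Assign ''gap'' gap_expr) Skip)
         (Assign ''k'' (Plus (Reg ''k'') (Num 1)))) s1 (csize (Seq (Cond (Less gap_expr (Reg ''gap'')) (Assign ''gap'' gap_expr) Skip)
         (Assign ''k'' (Plus (Reg ''k'') (Num 1))))) (inv_k v t j (Suc k))"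
  proof (rule straight_Seq)
    let ?e = "2 ^ t - (\<phi> v k + start v t j) mod 2 ^ t"
    have e: "nval bound gap_expr s1 ?e" using gap_expr_nval s1 le by blast
    have "?g k \<le> bound"
      using run_length_le[of "2 ^ t" "\<phi> v" "start v t j" k] pow_le_bound[of t] le(2) by linarith
    then have g: "nval bound (Reg ''gap'') s1 (?g k)" using s1 by (intro nval_Reg) auto
    show "runs bound (Cond (Less gap_expr (Reg ''gap'')) (Assign ''gap'' gap_expr) Skip) s1
      (csize (Cond (Less gap_expr (Reg ''gap'')) (Assign ''gap'' gap_expr) Skip)) ?Q2"
    proof (rule straight_Cond[OF bev_Less[OF e g]])
      assume "?e < ?g k"
      then show "runs bound (Assign ''gap'' gap_expr) s1 (csize (Assign ''gap'' gap_expr)) ?Q2"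
        using s1 by (intro straight_Assign[OF e]) (simp add: min_def)
    next
      assume "\<not> ?e < ?g k"
      then show "runs bound Skip s1 (csize Skip) ?Q2"
        using s1 by (intro straight_Skip) (simp add: min_def)
    qed
    fix s2 assume s2: "?Q2 s2"
    have k: "k + 1 \<le> bound" "k \<le> bound" "1 \<le> bound" using le(3) d_le_bound by linarith+
    have "nval bound (Plus (Reg ''k'') (Num 1)) s2 (k + 1)"
      using s2 by (intro nval_Plus nval_Reg nval_Num_1 k) (simp add: inv_s_def)
    then show "runs bound (Assign ''k'' (Plus (Reg ''k'') (Num 1))) s2
      (csize (Assign ''k'' (Plus (Reg ''k'') (Num 1)))) (inv_k v t j (Suc k))"
      using s2 by (intro straight_Assign) (auto simp: inv_k_def inv_s_def inv_j_def inv_T_def loop_inv_def)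
  qed
qed

lemma run_init_runs:
  assumes inv: "inv_j v t j s" and le: "v < n" "t \<le> l" "j \<le> d"
  shows "runs bound run_init s (csize run_init) (inv_k v t j 0)"
  unfolding run_init_def
proof (rule straight_Seq)
  let ?Q1 = "\<lambda>s. inv_j v t j s \<and> regs s ''s'' = int (start v t j)"
  let ?Q2 = "\<lambda>s. ?Q1 s \<and> regs s ''code'' = int (2 ^ t)"
  let ?Q3 = "\<lambda>s. ?Q2 s \<and> regs s ''gap'' = int (2 ^ t - start v t j)"
  let ?e = "Modulo (Minus (Reg ''T'')
     (Modulo (Arr ''phi'' (Plus (Times (Reg ''v'') (Reg ''d'')) (Reg ''j''))) (Reg ''T''))) (Reg ''T'')"
  have s: "regs s ''T'' = int (2 ^ t)" "regs s ''j'' = int j" "regs s ''v'' = int v" "regs s ''d'' = int d"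
    "\<And>k. k < d \<Longrightarrow> arrs s ''phi'' (int (v * d + k)) = int (\<phi> v k)"
    using inv le(1) unfolding inv_j_def inv_T_def loop_inv_def by blast+
  have b: "2 ^ t \<le> bound" "v \<le> bound" "d \<le> bound" "j \<le> bound" "v * d + j \<le> bound" "v * d \<le> bound"
    using pow_le_bound[of t] phi_index_le[OF le(1), of j] n_le_bound d_le_bound le by linarith+
  show "runs bound (Cond (Less (Reg ''j'') (Reg ''d'')) (Assign ''s'' ?e) (Assign ''s'' (Num 0))) s
     (csize (Cond (Less (Reg ''j'') (Reg ''d'')) (Assign ''s'' ?e) (Assign ''s'' (Num 0)))) ?Q1"
  proof (rule straight_Cond[OF bev_Less[OF nval_Reg[OF s(2) b(4)] nval_Reg[OF s(4) b(3)]]])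
    assume j: "j < d"
    have \<phi>: "\<phi> v j \<le> bound" using coord_range[OF le(1) j] base_le_bound by auto
    have m: "\<phi> v j mod 2 ^ t \<le> 2 ^ t" by (rule less_imp_le_nat[OF mod_less_divisor]) simp
    have "nval bound ?e s (start v t j)"
      unfolding start_def run_start_def if_P[OF j]
      by (intro nval_Modulo nval_Minus nval_Arr[where i = "v * d + j"] nval_Plus nval_Times nval_Reg s b j \<phi> m)
    then show "runs bound (Assign ''s'' ?e) s (csize (Assign ''s'' ?e)) ?Q1"
      by (rule straight_Assign) (use inv in \<open>auto simp: inv_j_def inv_T_def loop_inv_def\<close>)
  next
    assume "\<not> j < d"
    then have "start v t j = 0" by (simp add: start_def run_start_def)
    then show "runs bound (Assign ''s'' (Num 0)) s (csize (Assign ''s'' (Num 0))) ?Q1"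
      by (intro straight_Assign[OF nval_Num_0]) (use inv in \<open>auto simp: inv_j_def inv_T_def loop_inv_def\<close>)
  qed
  fix s1 assume s1: "?Q1 s1"
  then have T: "regs s1 ''T'' = int (2 ^ t)" by (simp add: inv_j_def inv_T_def)
  show "runs bound (Seq (Assign ''code'' (Reg ''T'')) (Seq (Assign ''gap'' (Minus (Reg ''T'') (Reg ''s'')))
         (Assign ''k'' (Num 0)))) s1 (csize (Seq (Assign ''code'' (Reg ''T'')) (Seq (Assign ''gap'' (Minus (Reg ''T'') (Reg ''s'')))
         (Assign ''k'' (Num 0))))) (inv_k v t j 0)"
  proof (rule straight_Seq)
    show "runs bound (Assign ''code'' (Reg ''T'')) s1 (csize (Assign ''code'' (Reg ''T''))) ?Q2"
      by (rule straight_Assign[OF nval_Reg[OF T b(1)]])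
        (use s1 in \<open>auto simp: inv_j_def inv_T_def loop_inv_def\<close>)
    fix s2 assume s2: "?Q2 s2"
    then have T2: "regs s2 ''T'' = int (2 ^ t)" by (simp add: inv_j_def inv_T_def)
    show "runs bound (Seq (Assign ''gap'' (Minus (Reg ''T'') (Reg ''s''))) (Assign ''k'' (Num 0))) s2
      (csize (Seq (Assign ''gap'' (Minus (Reg ''T'') (Reg ''s''))) (Assign ''k'' (Num 0)))) (inv_k v t j 0)"
    proof (rule straight_Seq)
      have "nval bound (Minus (Reg ''T'') (Reg ''s'')) s2 (2 ^ t - start v t j)"
        using s2 b(1) start_less[of v t j]
        by (intro nval_Minus nval_Reg T2) auto
      then show "runs bound (Assign ''gap'' (Minus (Reg ''T'') (Reg ''s''))) s2
        (csize (Assign ''gap'' (Minus (Reg ''T'') (Reg ''s'')))) ?Q3"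
        by (rule straight_Assign) (use s2 in \<open>auto simp: inv_j_def inv_T_def loop_inv_def\<close>)
      fix s3 assume "?Q3 s3"
      then show "runs bound (Assign ''k'' (Num 0)) s3 (csize (Assign ''k'' (Num 0))) (inv_k v t j 0)"
        by (intro straight_Assign[OF nval_Num_0])
          (auto simp: inv_k_def inv_s_def inv_j_def inv_T_def loop_inv_def)
    qed
  qed
qed

text \<open>The end of a run is again the row of \<open>v\<close> at a valid shift, so the bound on
  row indices covers it; a run is never empty.\<close>

lemma hi_less:
  assumes "v < n" "t \<le> l"
  shows "hi v t j < base ^ (d + 2)" "lo v t j \<le> hi v t j"
    "hi v t j = row_index base d (2 ^ t) (\<phi> v) (start v t j + run_length (2 ^ t) (\<phi> v) (start v t j) d - 1)"
proof -
  let ?g = "run_length (2 ^ t) (\<phi> v) (start v t j) d"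
  have g: "?g > 0" "?g \<le> 2 ^ t - start v t j"
    using run_length_pos run_length_le start_less by blast+
  have "row_index base d (2 ^ t) (\<phi> v) (start v t j + (?g - 1)) = lo v t j + (?g - 1)"
    unfolding lo_def using g(1) by (intro row_index_run) simp
  then show eq: "hi v t j = row_index base d (2 ^ t) (\<phi> v) (start v t j + ?g - 1)"
    using g(1) by (simp add: hi_def)
  have "start v t j + ?g - 1 < 2 ^ t" using g start_less[of v t j] by linarith
  then show "hi v t j < base ^ (d + 2)"
    unfolding eq using row_less[of t "start v t j + ?g - 1" v] assms by (simp add: grid_row_def)
  show "lo v t j \<le> hi v t j" using g(1) by (simp add: hi_def)
qed

lemma run_emit_runs:
  assumes inv: "inv_k v t j d s" and le: "v < n" "t \<le> l" "j \<le> d"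
  shows "runs bound run_emit s (csize run_emit) (inv_j v t (Suc j))"
  unfolding run_emit_def
proof (rule straight_Seq)
  let ?g = "run_length (2 ^ t) (\<phi> v) (start v t j) d"
  let ?P = "pos v t j"
  let ?c = "cell_code base (2 ^ t) (\<phi> v) (start v t j) d"
  have s: "inv_s v t j d s" "regs s ''code'' = int ?c" "regs s ''gap'' = int ?g" "regs s ''s'' = int (start v t j)"
    using inv by (auto simp: inv_k_def inv_s_def)
  have top: "base ^ (d + 2) \<le> bound" by (simp add: bound_def)
  have g: "1 \<le> ?g" using run_length_pos[of "start v t j" "2 ^ t"] start_less[of v t j] by (simp add: Suc_le_eq)
  have lo: "lo v t j + ?g \<le> bound" using hi_less(1)[OF le(1,2), of j] top g by (simp add: hi_def)
  have c: "?c * base + start v t j = lo v t j" by (simp add: lo_def row_index_def)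
  have pos: "Suc ?P \<le> bound" "v \<le> bound" "j + 1 \<le> bound" "1 \<le> bound"
    using pos_less[OF le] le n_le_bound d_le_bound unfolding bound_def by linarith+
  have "t * Suc d + j + 1 \<le> Suc ?P" by (simp add: pos_def algebra_simps)
  then have size: "t * Suc d + j + 1 \<le> bound" using pos(1) by linarith
  let ?Q = "\<lambda>s. inv_j v t j s \<and> regs s ''code'' = int (lo v t j) \<and> regs s ''gap'' = int ?g"
  show "runs bound (Assign ''code'' (Plus (Times (Reg ''code'') base_expr) (Reg ''s''))) s
    (csize (Assign ''code'' (Plus (Times (Reg ''code'') base_expr) (Reg ''s'')))) ?Q"
  proof (rule straight_Assign)
    show "nval bound (Plus (Times (Reg ''code'') base_expr) (Reg ''s'')) s (?c * base + start v t j)"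
      using lo c code_le[OF le(1) le_refl le(2), of j]
      by (intro nval_Plus nval_Times nval_Reg s base_expr_nval[OF inv_s_loop_inv[OF s(1)]]) linarith+
    show "?Q (s\<lparr>regs := (regs s)(''code'' := int (?c * base + start v t j))\<rparr>)"
      unfolding c using s by (auto simp: inv_s_def inv_j_def inv_T_def loop_inv_def)
  qed
  fix s1 assume s1: "?Q s1"
  then have r: "regs s1 ''p'' = int ?P" "regs s1 ''code'' = int (lo v t j)" "regs s1 ''gap'' = int ?g"
    "regs s1 ''v'' = int v" "regs s1 ''j'' = int j" "arrs s1 ''size'' (int v) = int (t * Suc d + j)"
    by (auto simp: inv_j_def inv_T_def loop_inv_def)
  \<comment> \<open>The states after the single instructions, spelled out so that the symbolic
    execution at the end only has to match them.\<close>
  let ?s2 = "s1\<lparr>arrs := (arrs s1)(''lo'' := (arrs s1 ''lo'')(int ?P := int (lo v t j)))\<rparr>"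
  let ?s3 = "?s2\<lparr>arrs := (arrs ?s2)(''hi'' := (arrs ?s2 ''hi'')(int ?P := int (lo v t j + ?g - 1)))\<rparr>"
  let ?s4 = "?s3\<lparr>arrs := (arrs ?s3)(''num'' := (arrs ?s3 ''num'')(int ?P := int 1))\<rparr>"
  let ?s5 = "?s4\<lparr>arrs := (arrs ?s4)(''den'' := (arrs ?s4 ''den'')(int ?P := int 1))\<rparr>"
  let ?s6 = "?s5\<lparr>arrs := (arrs ?s5)(''size'' := (arrs ?s5 ''size'')(int v := int (t * Suc d + j + 1)))\<rparr>"
  let ?s7 = "?s6\<lparr>regs := (regs ?s6)(''p'' := int (?P + 1))\<rparr>"
  let ?s8 = "?s7\<lparr>regs := (regs ?s7)(''j'' := int (j + 1))\<rparr>"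
  have "inv_j v t (Suc j) ?s8"
  proof -
    have "pos v t (Suc j) = Suc ?P" by (simp add: pos_def)
    then show ?thesis
      using s1 at_pos_pos[OF le(2,3), of lo v] at_pos_pos[OF le(2,3), of hi v]
      by (auto simp: inv_j_def inv_T_def loop_inv_def less_Suc_eq hi_def)
  qed
  moreover have "nval bound (Reg ''p'') s1 ?P" "nval bound (Reg ''code'') s1 (lo v t j)"
    "nval bound (Reg ''p'') ?s2 ?P" "nval bound (Minus (Plus (Reg ''code'') (Reg ''gap'')) (Num 1)) ?s2 (lo v t j + ?g - 1)"
    "nval bound (Reg ''p'') ?s3 ?P" "nval bound (Num 1) ?s3 1"
    "nval bound (Reg ''p'') ?s4 ?P" "nval bound (Num 1) ?s4 1"
    "nval bound (Reg ''v'') ?s5 v" "nval bound (Plus (Arr ''size'' (Reg ''v'')) (Num 1)) ?s5 (t * Suc d + j + 1)"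
    "nval bound (Plus (Reg ''p'') (Num 1)) ?s6 (?P + 1)"
    "nval bound (Plus (Reg ''j'') (Num 1)) ?s7 (j + 1)"
    by (intro nval_Reg nval_Minus nval_Plus nval_Num_1 nval_Arr[where i = v];
        use lo g pos size r in \<open>simp del: mult_Suc_right\<close>)+
  ultimately show "runs bound (Seq (Store ''lo'' (Reg ''p'') (Reg ''code''))
    (Seq (Store ''hi'' (Reg ''p'') (Minus (Plus (Reg ''code'') (Reg ''gap'')) (Num 1)))
    (Seq (Store ''num'' (Reg ''p'') (Num 1))
    (Seq (Store ''den'' (Reg ''p'') (Num 1))
    (Seq (Store ''size'' (Reg ''v'') (Plus (Arr ''size'' (Reg ''v'')) (Num 1)))
    (Seq (Assign ''p'' (Plus (Reg ''p'') (Num 1)))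
         (Assign ''j'' (Plus (Reg ''j'') (Num 1)))))))))
    s1 (csize (Seq (Store ''lo'' (Reg ''p'') (Reg ''code''))
    (Seq (Store ''hi'' (Reg ''p'') (Minus (Plus (Reg ''code'') (Reg ''gap'')) (Num 1)))
    (Seq (Store ''num'' (Reg ''p'') (Num 1))
    (Seq (Store ''den'' (Reg ''p'') (Num 1))
    (Seq (Store ''size'' (Reg ''v'') (Plus (Arr ''size'' (Reg ''v'')) (Num 1)))
    (Seq (Assign ''p'' (Plus (Reg ''p'') (Num 1)))
         (Assign ''j'' (Plus (Reg ''j'') (Num 1)))))))))) (inv_j v t (Suc j))"
    by (intro straight_Seq_direct straight_Store straight_Assign)
qed

end

section \<open>Correctness and running time\<close>

context vertex_grid
begin

definition run_cost :: nat where
  "run_cost = csize run_init + (d * (bsize (Less (Reg ''k'') (Reg ''d'')) + 1 + csize coord_step)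
     + (bsize (Less (Reg ''k'') (Reg ''d'')) + 1) + csize run_emit)"

lemma run_step_runs:
  assumes inv: "inv_j v t j s" and le: "v < n" "t \<le> l" "j \<le> d"
  shows "runs bound run_step s run_cost (inv_j v t (Suc j))"
  unfolding run_step_def run_cost_def
proof (rule runs_Seq[OF runs_mono[OF run_init_runs[OF assms] le_refl]])
  fix s0 assume s0: "inv_k v t j 0 s0"
  show "runs bound (Seq (While (Less (Reg ''k'') (Reg ''d'')) coord_step) run_emit) s0
    (d * (bsize (Less (Reg ''k'') (Reg ''d'')) + 1 + csize coord_step)
      + (bsize (Less (Reg ''k'') (Reg ''d'')) + 1) + csize run_emit) (inv_j v t (Suc j))"
  proof (rule runs_Seq[OF runs_mono[OF runs_While[where I = "\<lambda>k. inv_k v t j k" and m = d] le_refl]])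
    have guard: "bev bound (Less (Reg ''k'') (Reg ''d'')) s (k < d)" if "inv_k v t j k s" "k \<le> d" for k s
    proof -
      have "regs s ''k'' = int k" "regs s ''d'' = int d"
        using that(1) by (auto simp: inv_k_def inv_s_def inv_j_def inv_T_def loop_inv_def)
      then show ?thesis using that(2) d_le_bound by (intro bev_Less nval_Reg) auto
    qed
    show "bev bound (Less (Reg ''k'') (Reg ''d'')) s False" if "inv_k v t j d s" for s
      using guard[OF that] by simp
    show "bev bound (Less (Reg ''k'') (Reg ''d'')) s True \<and>
        runs bound coord_step s (csize coord_step) (inv_k v t j (Suc k))"
      if "k < d" "inv_k v t j k s" for k s
      using guard[OF that(2)] coord_step_runs[OF that(2) le(1,2) that(1)] that(1) by simp
    show "inv_k v t j 0 s0" by fact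
    show "runs bound run_emit s (csize run_emit) (inv_j v t (Suc j))" if "inv_k v t j d s" for s
      by (rule run_emit_runs[OF that le])
  qed
qed

definition level_cost :: nat where
  "level_cost = csize (Assign ''j'' (Num 0)) +
     (Suc d * (bsize (Neg (Less (Reg ''d'') (Reg ''j''))) + 1 + run_cost)
      + (bsize (Neg (Less (Reg ''d'') (Reg ''j''))) + 1) + csize (Assign ''T'' (Times (Num 2) (Reg ''T''))))"

lemma level_step_runs:
  assumes inv: "inv_T v t 0 s" and le: "v < n" "t \<le> l"
  shows "runs bound level_step s level_cost (inv_T v (Suc t) 0)"
  unfolding level_step_def level_cost_def
proof (rule runs_Seq[OF runs_mono[OF straight_Assign[OF nval_Num_0] le_refl]])
  show "inv_j v t 0 (s\<lparr>regs := (regs s)(''j'' := int 0)\<rparr>)"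
    using inv by (simp add: inv_j_def inv_T_def loop_inv_def)
  fix s0 assume s0: "inv_j v t 0 s0"
  let ?b = "Neg (Less (Reg ''d'') (Reg ''j''))"
  show "runs bound (Seq (While ?b run_step) (Assign ''T'' (Times (Num 2) (Reg ''T'')))) s0
    (Suc d * (bsize ?b + 1 + run_cost) + (bsize ?b + 1) + csize (Assign ''T'' (Times (Num 2) (Reg ''T''))))
    (inv_T v (Suc t) 0)"
  proof (rule runs_Seq[OF runs_mono[OF runs_While[where I = "\<lambda>j. inv_j v t j" and m = "Suc d"] le_refl]])
    have guard: "bev bound ?b s (\<not> d < j)" if "inv_j v t j s" "j \<le> Suc d" for j s
    proof -
      have "regs s ''j'' = int j" "regs s ''d'' = int d"
        using that(1) by (auto simp: inv_j_def inv_T_def loop_inv_def)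
      then show ?thesis using that(2) d_le_bound by (intro bev_Neg bev_Less nval_Reg) auto
    qed
    show "bev bound ?b s False" if "inv_j v t (Suc d) s" for s
      using guard[OF that] by simp
    show "bev bound ?b s True \<and> runs bound run_step s run_cost (inv_j v t (Suc j))"
      if "j < Suc d" "inv_j v t j s" for j s
      using guard[OF that(2)] run_step_runs[OF that(2) le] that(1) by (simp add: not_less)
    show "inv_j v t 0 s0" by fact
    fix s1 assume s1: "inv_j v t (Suc d) s1"
    then have T: "regs s1 ''T'' = int (2 ^ t)" by (simp add: inv_j_def inv_T_def)
    \<comment> \<open>After the last level \<open>T\<close> reaches \<open>2 ^ Suc l\<close>, one
      doubling beyond \<Delta>, which \<open>bound\<close> still covers.\<close>
    have "2 * 2 ^ t \<le> bound" "2 ^ t \<le> bound"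
      using pow_le_bound[of "Suc t"] pow_le_bound[of t] le(2) by simp_all
    then have "nval bound (Times (Num 2) (Reg ''T'')) s1 (2 * 2 ^ t)"
      by (intro nval_Times nval_Num_2 nval_Reg T two_le_bound)
    \<comment> \<open>The \<open>d + 1\<close> runs of a level fill its block exactly, so the next
      level starts at the very next position.\<close>
    moreover have "pos v t (Suc d) = pos v (Suc t) 0" by (simp add: pos_def)
    ultimately show "runs bound (Assign ''T'' (Times (Num 2) (Reg ''T''))) s1
        (csize (Assign ''T'' (Times (Num 2) (Reg ''T'')))) (inv_T v (Suc t) 0)"
      using s1 by (intro straight_Assign) (auto simp: inv_j_def inv_T_def loop_inv_def algebra_simps)
  qed
qed

definition vertex_cost :: nat where
  "vertex_cost = csize (Assign ''T'' (Num 1)) +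
     (Suc l * (bsize (Neg (Less (Reg ''Delta'') (Reg ''T''))) + 1 + level_cost)
      + (bsize (Neg (Less (Reg ''Delta'') (Reg ''T''))) + 1) + csize (Assign ''v'' (Plus (Reg ''v'') (Num 1))))"

lemma vertex_step_runs:
  assumes inv: "loop_inv v 0 0 s" and le: "v < n"
  shows "runs bound vertex_step s vertex_cost (loop_inv (Suc v) 0 0)"
  unfolding vertex_step_def vertex_cost_def
proof (rule runs_Seq[OF runs_mono[OF straight_Assign[OF nval_Num_1] le_refl]])
  show "1 \<le> bound" using two_le_bound by simp
  show "inv_T v 0 0 (s\<lparr>regs := (regs s)(''T'' := int 1)\<rparr>)"
    using inv by (simp add: inv_T_def loop_inv_def)
  fix s0 assume s0: "inv_T v 0 0 s0"
  let ?b = "Neg (Less (Reg ''Delta'') (Reg ''T''))"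
  show "runs bound (Seq (While ?b level_step) (Assign ''v'' (Plus (Reg ''v'') (Num 1)))) s0
    (Suc l * (bsize ?b + 1 + level_cost) + (bsize ?b + 1) + csize (Assign ''v'' (Plus (Reg ''v'') (Num 1))))
    (loop_inv (Suc v) 0 0)"
  proof (rule runs_Seq[OF runs_mono[OF runs_While[where I = "\<lambda>t. inv_T v t 0" and m = "Suc l"] le_refl]])
    have guard: "bev bound ?b s (\<not> (2::nat) ^ l < 2 ^ t)" if "inv_T v t 0 s" "t \<le> Suc l" for t s
    proof -
      have "regs s ''T'' = int (2 ^ t)" "regs s ''Delta'' = int (2 ^ l)"
        using that(1) unfolding inv_T_def loop_inv_def by blast+
      then show ?thesis using that(2) pow_le_bound by (intro bev_Neg bev_Less nval_Reg) auto
    qed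
    show "bev bound ?b s False" if "inv_T v (Suc l) 0 s" for s
      using guard[OF that] by simp
    show "bev bound ?b s True \<and> runs bound level_step s level_cost (inv_T v (Suc t) 0)"
      if "t < Suc l" "inv_T v t 0 s" for t s
      using guard[OF that(2)] level_step_runs[OF that(2) le] that(1) by (simp add: not_less)
    show "inv_T v 0 0 s0" by fact
    fix s1 assume s1: "inv_T v (Suc l) 0 s1"
    then have v: "regs s1 ''v'' = int v" by (simp add: inv_T_def loop_inv_def)
    have "v + 1 \<le> bound" "v \<le> bound" "1 \<le> bound" using le n_le_bound two_le_bound by linarith+
    then have "nval bound (Plus (Reg ''v'') (Num 1)) s1 (v + 1)"
      by (intro nval_Plus nval_Num_1 nval_Reg v)
    moreover have "pos v (Suc l) 0 = pos (Suc v) 0 0" by (simp add: pos_def)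
    ultimately show "runs bound (Assign ''v'' (Plus (Reg ''v'') (Num 1))) s1
        (csize (Assign ''v'' (Plus (Reg ''v'') (Num 1)))) (loop_inv (Suc v) 0 0)"
      using s1 by (intro straight_Assign) (auto simp: inv_T_def loop_inv_def less_Suc_eq)
  qed
qed

lemma embedding_prog_runs:
  assumes "loop_inv 0 0 0 s"
  shows "runs bound embedding_prog s (n * (bsize (Less (Reg ''v'') (Reg ''n'')) + 1 + vertex_cost)
    + (bsize (Less (Reg ''v'') (Reg ''n'')) + 1)) (loop_inv n 0 0)"
  unfolding embedding_prog_def
proof (rule runs_While[where I = "\<lambda>v. loop_inv v 0 0"])
  have guard: "bev bound (Less (Reg ''v'') (Reg ''n'')) s (v < n)" if "loop_inv v 0 0 s" "v \<le> n" for v s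
  proof -
    have "regs s ''v'' = int v" "regs s ''n'' = int n" using that(1) by (auto simp: loop_inv_def)
    then show ?thesis using that(2) n_le_bound by (intro bev_Less nval_Reg) auto
  qed
  show "bev bound (Less (Reg ''v'') (Reg ''n'')) s False" if "loop_inv n 0 0 s" for s
    using guard[OF that] by simp
  show "bev bound (Less (Reg ''v'') (Reg ''n'')) s True \<and> runs bound vertex_step s vertex_cost (loop_inv (Suc v) 0 0)"
    if "v < n" "loop_inv v 0 0 s" for v s
    using guard[OF that(2)] vertex_step_runs[OF that(2,1)] that(1) by simp
qed fact

lemma loop_inv_input: "loop_inv 0 0 0 (input_state n d (2 ^ l) \<phi>)"
proof -
  have "u * d + k < n * d" if "u < n" "k < d" for u k
    using that mult_le_mono1[of "Suc u" n d] by simp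
  then show ?thesis
    by (auto simp: loop_inv_def input_state_def pos_def nat_add_distrib nat_mult_distrib
        simp flip: of_nat_mult of_nat_add)
qed

section \<open>From the output arrays to compressed columns\<close>

lemma positions_of_vertex:
  "{v * (Suc l * Suc d)..<Suc v * (Suc l * Suc d)} = (\<lambda>(t, j). pos v t j) ` ({..l} \<times> {..d})"
proof (intro equalityI subsetI)
  fix q assume "q \<in> {v * (Suc l * Suc d)..<Suc v * (Suc l * Suc d)}"
  then have q: "v * (Suc l * Suc d) \<le> q" "q < v * (Suc l * Suc d) + Suc l * Suc d" by auto
  define r where "r = q - v * (Suc l * Suc d)"
  have r: "q = v * (Suc l * Suc d) + r" "r < Suc l * Suc d" using q unfolding r_def by linarith+
  have "r div Suc d < Suc l" using r(2) by (simp add: div_less_iff_less_mult del: mult_Suc mult_Suc_right)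
  moreover have "r mod Suc d < Suc d" by simp
  moreover have "q = pos v (r div Suc d) (r mod Suc d)"
    using div_mult_mod_eq[of r "Suc d"] unfolding pos_def r(1) add_mult_distrib mult.assoc by linarith
  ultimately show "q \<in> (\<lambda>(t, j). pos v t j) ` ({..l} \<times> {..d})" by force
next
  fix q assume "q \<in> (\<lambda>(t, j). pos v t j) ` ({..l} \<times> {..d})"
  then obtain t j where tj: "t \<le> l" "j \<le> d" "q = pos v t j" by auto
  have "t * Suc d + j < Suc l * Suc d"
    using mult_le_mono1[of "Suc t" "Suc l" "Suc d"] tj(1,2) by simp
  moreover have "q = v * (Suc l * Suc d) + (t * Suc d + j)"
    unfolding tj(3) pos_def by (simp add: algebra_simps)
  ultimately show "q \<in> {v * (Suc l * Suc d)..<Suc v * (Suc l * Suc d)}" by simp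
qed

lemma out_col_eq:
  assumes "loop_inv n 0 0 s" "v < n"
  shows "out_col s v = (\<lambda>(t, j). ((int (lo v t j), int (hi v t j)), 1)) ` ({..l} \<times> {..d})"
proof -
  have size: "out_size s i = Suc l * Suc d" if "i < n" for i
  proof -
    have "arrs s ''size'' (int i) = int (if i < n then Suc l * Suc d else if i = n then 0 * Suc d + 0 else 0)"
      using assms(1) unfolding loop_inv_def by blast
    then show ?thesis using that by (simp only: out_size_def if_True nat_int)
  qed
  \<comment> \<open>All columns record the same size, so the prefix sums in \<open>out_col\<close>
    are its multiples.\<close>
  have sum: "(\<Sum>j<i. out_size s j) = i * (Suc l * Suc d)" if "i \<le> n" for i
    using that by (simp add: size del: mult_Suc mult_Suc_right)
  have cell: "arrs s ''lo'' (int (pos v t j)) = int (lo v t j) \<and> arrs s ''hi'' (int (pos v t j)) = int (hi v t j) \<and>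
      arrs s ''num'' (int (pos v t j)) = 1 \<and> arrs s ''den'' (int (pos v t j)) = 1" if "t \<le> l" "j \<le> d" for t j
  proof -
    have "pos v t j < pos n 0 0"
      using pos_less[OF assms(2) that] by (simp add: pos_def del: mult_Suc mult_Suc_right)
    then show ?thesis
      using assms(1) at_pos_pos[OF that, of lo v] at_pos_pos[OF that, of hi v] unfolding loop_inv_def by simp
  qed
  have "Suc v \<le> n" "v \<le> n" using assms(2) by auto
  note le = this
  have "out_col s v = (\<lambda>p. ((arrs s ''lo'' (int p), arrs s ''hi'' (int p)),
           real_of_int (arrs s ''num'' (int p)) / real_of_int (arrs s ''den'' (int p)))) `
      (\<lambda>(t, j). pos v t j) ` ({..l} \<times> {..d})"
    unfolding out_col_def sum[OF le(1)] sum[OF le(2)] positions_of_vertex by (rule refl)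
  also have "\<dots> = (\<lambda>(t, j). ((int (lo v t j), int (hi v t j)), 1)) ` ({..l} \<times> {..d})"
    unfolding image_image by (intro image_cong refl) (auto simp: cell)
  finally show ?thesis .
qed

text \<open>Translates intervals of rows into runs of shifts, for which overlap and coverage are
  already settled.\<close>

lemma interval_eq:
  assumes "t \<le> l"
  shows "{lo v t j..hi v t j} = (\<lambda>r. grid_row t r v) `
    {start v t j..<start v t j + run_length (2 ^ t) (\<phi> v) (start v t j) d}"
proof -
  let ?s = "start v t j" and ?g = "run_length (2 ^ t) (\<phi> v) (start v t j) d"
  have g: "?g > 0" using run_length_pos start_less by blast
  have "{lo v t j..hi v t j} = (\<lambda>q. lo v t j + q) ` {..<?g}"
  proof (intro equalityI subsetI)
    fix x assume "x \<in> {lo v t j..hi v t j}"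
    then show "x \<in> (\<lambda>q. lo v t j + q) ` {..<?g}"
      using g by (intro image_eqI[of _ _ "x - lo v t j"]) (auto simp: hi_def)
  qed (auto simp: hi_def)
  also have "\<dots> = (\<lambda>q. grid_row t (?s + q) v) ` {..<?g}"
    by (intro image_cong refl) (auto simp: lo_def grid_row_def row_index_run)
  also have "\<dots> = (\<lambda>r. grid_row t r v) ` (\<lambda>q. ?s + q) ` {..<?g}" by (simp add: image_image)
  also have "(\<lambda>q. ?s + q) ` {..<?g} = {?s..<?s + ?g}"
    by (simp add: lessThan_atLeast0 image_add_atLeastLessThan add.commute)
  finally show ?thesis .
qed

text \<open>A common row fixes level and shift, so the two runs meet and
  \<open>runs_disjoint\<close> identifies their starts. Different \<open>j\<close> may share a
  start; their entries then coincide and collapse in the set \<open>out_col\<close>, so repetition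
  does not violate disjointness.\<close>

lemma intervals_meet:
  assumes "v < n" "t \<le> l" "t' \<le> l" "\<rho> \<in> {lo v t j..hi v t j}" "\<rho> \<in> {lo v t' j'..hi v t' j'}"
  shows "t = t' \<and> start v t j = start v t' j'"
proof -
  obtain r r' where r: "start v t j \<le> r" "r < start v t j + run_length (2 ^ t) (\<phi> v) (start v t j) d" "\<rho> = grid_row t r v"
    "start v t' j' \<le> r'" "r' < start v t' j' + run_length (2 ^ t') (\<phi> v) (start v t' j') d" "\<rho> = grid_row t' r' v"
    using assms(4,5) unfolding interval_eq[OF assms(2)] interval_eq[OF assms(3)] by auto
  have "r < 2 ^ t" "r' < 2 ^ t'"
    using r(2,5) run_length_le[of "2 ^ t" "\<phi> v" "start v t j" d] start_less[of v t j]
      run_length_le[of "2 ^ t'" "\<phi> v" "start v t' j'" d] start_less[of v t' j'] by linarith+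
  then have eq: "t = t'" "r = r'"
    using row_eq_iff[of t r v t' r' v] assms r(3,6) by auto
  have "start v t j' \<le> start v t j" "start v t j \<le> start v t j'"
    using runs_disjoint[of "2 ^ t" "start v t j" r "\<phi> v" d j'] runs_disjoint[of "2 ^ t" "start v t j'" r "\<phi> v" d j]
      r eq unfolding start_def by simp_all
  then show ?thesis using eq by simp
qed

lemma compressed_precond:
  assumes "loop_inv n 0 0 s"
  shows "compressed_mat (out_col s) precond"
  unfolding compressed_mat_def
proof (intro allI impI)
  fix v assume "v < dim_col precond"
  then have v: "v < n" by (simp add: precond_def)
  have dim: "dim_vec (col precond v) = base ^ (d + 2)" using precond_carrier by simp
  have col: "col precond v $ \<rho> = entry \<rho> v" if "\<rho> < base ^ (d + 2)" for \<rho>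
    using precond_carrier that v by (simp add: precond_nth)
  let ?J = "(\<lambda>(t, j). ((int (lo v t j), int (hi v t j)), 1 :: real)) ` ({..l} \<times> {..d})"
  have range: "int (lo v t j) \<le> int (hi v t j) \<and> int (hi v t j) < int (base ^ (d + 2))" if "t \<le> l" for t j
    using hi_less(1,2)[OF v that] by (simp only: of_nat_le_iff of_nat_less_iff simp_thms)
  have disjoint: "{int (lo v t j)..int (hi v t j)} \<inter> {int (lo v t' j')..int (hi v t' j')} = {}"
    if "t \<le> l" "t' \<le> l" "(lo v t j, hi v t j) \<noteq> (lo v t' j', hi v t' j')" for t j t' j'
  proof (rule ccontr)
    assume "\<not> ?thesis"
    then obtain z where "z \<in> {int (lo v t j)..int (hi v t j)}" "z \<in> {int (lo v t' j')..int (hi v t' j')}"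
      by blast
    then have "nat z \<in> {lo v t j..hi v t j}" "nat z \<in> {lo v t' j'..hi v t' j'}" by auto
    from intervals_meet[OF v that(1,2) this] that(3) show False by (auto simp: lo_def hi_def)
  qed
  have inside: "col precond v $ \<rho> = 1" if tj: "t \<le> l" "\<rho> \<in> {lo v t j..hi v t j}" "\<rho> < base ^ (d + 2)" for \<rho> t j
  proof -
    obtain r where "r < start v t j + run_length (2 ^ t) (\<phi> v) (start v t j) d" "\<rho> = grid_row t r v"
      using tj(2) unfolding interval_eq[OF tj(1)] by auto
    moreover from this have "r < 2 ^ t"
      using run_length_le[of "2 ^ t" "\<phi> v" "start v t j" d] start_less[of v t j] by linarith
    ultimately show ?thesis unfolding col[OF tj(3)] using tj(1) by (auto simp: entry_def)
  qed
  have outside: "col precond v $ \<rho> = 0"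
    if \<rho>: "\<rho> < base ^ (d + 2)" "\<And>t j. t \<le> l \<Longrightarrow> j \<le> d \<Longrightarrow> \<rho> \<notin> {lo v t j..hi v t j}" for \<rho>
  proof -
    have "\<rho> \<noteq> grid_row t r v" if tr: "t \<le> l" "r < 2 ^ t" for t r
    proof
      assume eq: "\<rho> = grid_row t r v"
      obtain j where j: "j \<le> d" "start v t j \<le> r"
        "r < start v t j + run_length (2 ^ t) (\<phi> v) (start v t j) d"
        using runs_cover[OF tr(2), of d "\<phi> v"] unfolding start_def by metis
      then have "\<rho> \<in> {lo v t j..hi v t j}" unfolding interval_eq[OF tr(1)] eq by auto
      then show False using \<rho>(2) tr(1) j(1) by blast
    qed
    then show ?thesis unfolding col[OF \<rho>(1)] entry_def by auto
  qed
  show "compressed_vec (out_col s v) (col precond v)"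
    unfolding compressed_vec_def dim out_col_eq[OF assms v]
  proof (intro conjI)
    show "\<forall>((a, b), c)\<in>?J. 0 \<le> a \<and> a \<le> b \<and> b < int (base ^ (d + 2))"
      using range by (auto simp del: of_nat_power power_Suc add_2_eq_Suc')
    show "\<forall>((a, b), c)\<in>?J. \<forall>((a', b'), c')\<in>?J. ((a, b), c) \<noteq> ((a', b'), c') \<longrightarrow> {a..b} \<inter> {a'..b'} = {}"
      unfolding ball_simps using disjoint by (fastforce simp del: Int_atLeastAtMost)
    show "\<forall>((a, b), c)\<in>?J. \<forall>j<base ^ (d + 2). int j \<in> {a..b} \<longrightarrow> col precond v $ j = c"
      using inside by (auto simp del: index_col power_Suc add_2_eq_Suc')
    show "\<forall>j<base ^ (d + 2). (\<forall>((a, b), c)\<in>?J. int j \<notin> {a..b}) \<longrightarrow> col precond v $ j = 0"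
    proof (intro allI impI outside)
      fix \<rho> t j assume H: "\<forall>((a, b), c)\<in>?J. int \<rho> \<notin> {a..b}" and tj: "t \<le> l" "j \<le> d"
      have "((int (lo v t j), int (hi v t j)), 1) \<in> ?J"
        using tj by (intro image_eqI[of _ _ "(t, j)"]) auto
      from bspec[OF H this] have "int \<rho> \<notin> {int (lo v t j)..int (hi v t j)}" by simp
      then show "\<rho> \<notin> {lo v t j..hi v t j}" by simp
    qed
  qed simp
qed

lemma card_out_col:
  assumes "loop_inv n 0 0 s" "v < n"
  shows "card (out_col s v) \<le> (d + 1) * (l + 1)"
proof -
  have "card (out_col s v) \<le> card ({..l} \<times> {..d})"
    unfolding out_col_eq[OF assms] by (rule card_image_le) auto
  then show ?thesis by (simp add: mult.commute)
qed

end

section \<open>Explicit bounds on the running time\<close>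

context vertex_grid
begin

definition prog_cost :: nat where
  "prog_cost = n * (bsize (Less (Reg ''v'') (Reg ''n'')) + 1 + vertex_cost)
    + (bsize (Less (Reg ''v'') (Reg ''n'')) + 1)"

lemma run_cost_le: "run_cost \<le> 300 * Suc d"
  by (simp add: run_cost_def run_init_def coord_step_def run_emit_def base_expr_def shifted_coord_def gap_expr_def)

lemma level_cost_le: "level_cost \<le> 340 * (Suc d * Suc d)"
proof -
  have "level_cost \<le> Suc d * (20 + run_cost) + 20" by (simp add: level_cost_def algebra_simps)
  also have "\<dots> \<le> Suc d * (20 + 300 * Suc d) + 20"
    using run_cost_le by (intro add_mono mult_le_mono le_refl)
  also have "\<dots> \<le> (2 * 20 + 300) * (Suc d * Suc d)" by (rule loop_cost_le) auto
  finally show ?thesis by simp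
qed

lemma vertex_cost_le: "vertex_cost \<le> 380 * (Suc l * (Suc d * Suc d))"
proof -
  have "vertex_cost \<le> Suc l * (20 + level_cost) + 20" by (simp add: vertex_cost_def algebra_simps)
  also have "\<dots> \<le> Suc l * (20 + 340 * (Suc d * Suc d)) + 20"
    using level_cost_le by (intro add_mono mult_le_mono le_refl)
  also have "\<dots> \<le> (2 * 20 + 340) * (Suc l * (Suc d * Suc d))" by (rule loop_cost_le) auto
  finally show ?thesis by simp
qed

lemma prog_cost_le:
  assumes "n \<ge> 1"
  shows "prog_cost \<le> 420 * (n * (Suc l * (Suc d * Suc d)))"
proof -
  have "prog_cost \<le> n * (20 + vertex_cost) + 20" by (simp add: prog_cost_def algebra_simps)
  also have "\<dots> \<le> n * (20 + 380 * (Suc l * (Suc d * Suc d))) + 20"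
    using vertex_cost_le by (intro add_mono mult_le_mono le_refl)
  also have "\<dots> \<le> (2 * 20 + 380) * (n * (Suc l * (Suc d * Suc d)))"
    using assms by (intro loop_cost_le) auto
  finally show ?thesis by simp
qed

lemma main_prog_runs:
  assumes "n \<ge> 2" "d \<ge> 1"
  shows "runs bound main_prog (input_state n d (2 ^ l) \<phi>) (430 * (n * (Suc l * (Suc d * Suc d)))) (loop_inv n 0 0)"
proof -
  let ?s = "input_state n d (2 ^ l) \<phi>"
  have s: "regs ?s ''n'' = int n" "regs ?s ''d'' = int d" by (simp_all add: input_state_def)
  have b: "n \<le> bound" "d \<le> bound" "1 \<le> bound" "2 \<le> bound"
    using n_le_bound d_le_bound two_le_bound by linarith+
  have "runs bound main_prog ?s
    (bsize (Less (Reg ''n'') (Num 2)) + 1 + (bsize (Less (Reg ''d'') (Num 1)) + 1 + prog_cost)) (loop_inv n 0 0)"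
    unfolding main_prog_def
  proof (rule runs_Cond[OF bev_Less[OF nval_Reg[OF s(1) b(1)] nval_Num_2[OF b(4)]]])
    show "runs bound (Cond (Less (Reg ''d'') (Num 1)) Skip embedding_prog) ?s
      (bsize (Less (Reg ''d'') (Num 1)) + 1 + prog_cost) (loop_inv n 0 0)"
    proof (rule runs_Cond[OF bev_Less[OF nval_Reg[OF s(2) b(2)] nval_Num_1[OF b(3)]]])
      show "runs bound embedding_prog ?s prog_cost (loop_inv n 0 0)"
        unfolding prog_cost_def by (rule embedding_prog_runs[OF loop_inv_input])
    qed (use assms(2) in simp)
  qed (use assms(1) in simp)
  moreover have "bsize (Less (Reg ''n'') (Num 2)) + 1 + (bsize (Less (Reg ''d'') (Num 1)) + 1 + prog_cost)
      \<le> 430 * (n * (Suc l * (Suc d * Suc d)))"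
  proof -
    have "1 * (1 * (1 * 1)) \<le> n * (Suc l * (Suc d * Suc d))"
      using assms(1) by (intro mult_le_mono) auto
    \<comment> \<open>Each of the two tests costs \<open>4 + 1\<close>; raising 420 to 430 absorbs
      both.\<close>
    then have "10 + prog_cost \<le> 430 * (n * (Suc l * (Suc d * Suc d)))"
      using prog_cost_le assms(1) by linarith
    then show ?thesis by simp
  qed
  ultimately show ?thesis by (rule runs_mono)
qed

text \<open>Crude bounds such as \<open>Suc d \<le> 2 ^ Suc d\<close> suffice, since the length only
  has to be polynomial in \<open>d\<close>, \<open>L\<close> and the logarithm of \<open>n\<close>.
  The final 3 is one bit for the sum, one for strictness and the sign.\<close>

lemma len_bound_le:
  assumes "n \<le> 2 ^ a"
  shows "len (int bound) \<le> a + (l + 1) + (d + 1) + (l + 1) * (d + 2) + 3"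
proof -
  let ?e = "a + Suc l + Suc d + (l + 1) * (d + 2)"
  have "n * Suc l * Suc d \<le> 2 ^ a * 2 ^ Suc l * 2 ^ Suc d"
    by (intro mult_le_mono assms less_imp_le_nat[OF less_exp])
  also have "\<dots> = 2 ^ (a + Suc l + Suc d)" by (simp only: power_add)
  also have "\<dots> \<le> 2 ^ ?e" by (intro power_increasing) auto
  finally have "n * Suc l * Suc d \<le> 2 ^ ?e" .
  moreover have "base ^ (d + 2) \<le> 2 ^ ?e"
  proof -
    have "base = 2 ^ (l + 1)" by (simp add: base_def)
    then have "base ^ (d + 2) = 2 ^ ((l + 1) * (d + 2))" by (simp only: power_mult)
    also have "\<dots> \<le> 2 ^ ?e" by (intro power_increasing) auto
    finally show ?thesis .
  qed
  ultimately have "bound \<le> 2 ^ ?e + 2 ^ ?e" unfolding bound_def by (rule add_mono)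
  also have "\<dots> < 2 ^ (?e + 2)" by simp
  finally have "int bound < 2 ^ (?e + 2)" by (metis of_nat_less_iff of_nat_numeral of_nat_power)
  then have "len (int bound) \<le> Suc (?e + 2)" by (simp only: len_le_iff of_nat_0_le_iff)
  then show ?thesis by simp
qed

text \<open>Here \<open>y\<close> is at least 1 and dominates \<open>L\<close>, \<open>d\<close> and
  the logarithm of \<open>n\<close> separately. Bounding \<open>L\<close> by \<open>y\<close>, each
  \<open>d + 1\<close> by \<open>2 * y\<close> and the length by \<open>11 * y\<close> gives
  \<open>430 * 4 * 121 = 208120\<close>, rounded up.\<close>

lemma time_le:
  assumes "n \<ge> 2" "d \<ge> 1" "y = real d * (1 + real l) * log 2 (real n)"
  shows "real (430 * (n * (Suc l * (Suc d * Suc d))) * (len (int bound))\<^sup>2) \<le> real n * (210000 * y ^ 5)"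
proof -
  define a where "a = nat \<lceil>log 2 (real n)\<rceil>"
  have log: "log 2 (real n) \<ge> 1" using assms(1) by (simp add: le_log_iff)
  then have a: "log 2 (real n) \<le> real a" "real a \<le> log 2 (real n) + 1" unfolding a_def by linarith+
  have "real n = 2 powr log 2 (real n)" using assms(1) by simp
  also have "\<dots> \<le> 2 powr real a" using a(1) by simp
  finally have "real n \<le> 2 ^ a" by (simp add: powr_realpow)
  then have "n \<le> 2 ^ a" by (metis of_nat_le_iff of_nat_numeral of_nat_power)
  then have "real (len (int bound)) \<le> real (a + (l + 1) + (d + 1) + (l + 1) * (d + 2) + 3)"
    by (intro of_nat_mono len_bound_le)
  then have len: "real (len (int bound)) \<le> real a + (1 + real l) + (real d + 1) + (1 + real l) * (real d + 2) + 3"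
    by (simp add: algebra_simps)
  let ?L = "1 + real l" and ?g = "log 2 (real n)"
  have d: "real d \<ge> 1" using assms(2) by simp
  have L: "?L \<ge> 1" by simp
  have dL: "real d * ?L \<ge> 1" "?L \<le> real d * ?L" "real d \<le> real d * ?L"
    using mult_mono[OF d L] mult_right_mono[OF d, of ?L] mult_left_mono[OF L, of "real d"] d by simp_all
  have y: "real d * ?L \<le> y" "?g \<le> y"
    using mult_left_mono[OF log, of "real d * ?L"] mult_right_mono[OF dL(1), of ?g] dL(1) log
    unfolding assms(3) by simp_all
  then have y1: "1 \<le> y" using log by linarith
  have "?L * (real d + 2) \<le> ?L * (3 * real d)" using d by (intro mult_left_mono) auto
  then have "?L * (real d + 2) \<le> 3 * y" using y(1) by (simp add: algebra_simps)
  \<comment> \<open>The summands total at most \<open>6 * y + 5\<close>, and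
    \<open>1 \<le> y\<close>.\<close>
  then have len_y: "real (len (int bound)) \<le> 11 * y"
    using len a(2) y y1 dL by linarith
  then have sq: "(real (len (int bound)))\<^sup>2 \<le> (11 * y)\<^sup>2" by (intro power_mono) auto
  have prod: "?L * ((real d + 1) * (real d + 1)) \<le> y * ((2 * y) * (2 * y))"
  proof -
    have "?L \<le> y" "real d + 1 \<le> 2 * y" "0 \<le> y" "0 \<le> 2 * y" "0 \<le> real d + 1"
      using y y1 dL d by linarith+
    then show ?thesis by (intro mult_mono mult_nonneg_nonneg zero_le_numeral)
  qed
  have "430 * (real n * (?L * ((real d + 1) * (real d + 1)))) * (real (len (int bound)))\<^sup>2
      \<le> 430 * (real n * (y * ((2 * y) * (2 * y)))) * (11 * y)\<^sup>2"
  proof (rule mult_mono[OF _ sq])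
    show "430 * (real n * (?L * ((real d + 1) * (real d + 1)))) \<le> 430 * (real n * (y * ((2 * y) * (2 * y))))"
      using prod by (simp only: mult_left_mono of_nat_0_le_iff zero_le_numeral)
  qed (use y1 in auto)
  also have "\<dots> = real n * (208120 * y ^ 5)"
    by (simp add: power2_eq_square eval_nat_numeral algebra_simps)
  also have "\<dots> \<le> real n * (210000 * y ^ 5)"
    using y1 by (intro mult_left_mono mult_right_mono) auto
  finally show ?thesis by (simp add: algebra_simps)
qed

text \<open>Positive graph distances and the lower bound make \<phi> injective; a pair of distinct
  vertices also forces \<alpha> to be nonnegative. These are the remaining premises of
  \<open>kappa_precond_le\<close>.\<close>

lemma main_prog_correct:
  assumes "n \<ge> 2" "d \<ge> 1" "weighted_graph n E w es"
    and dist: "\<forall>u<n. \<forall>v<n. real (graph_dist n E w u v) \<le> coord_dist d (\<phi> u) (\<phi> v) \<and>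
      coord_dist d (\<phi> u) (\<phi> v) \<le> \<alpha> * real (graph_dist n E w u v)"
  shows "full_column_rank precond"
    "kappa (precond * incidence_mat n es * the (mat_inverse (weight_mat es w)))
      \<le> ennreal (4 * \<alpha> * (1 + real l) * real d)"
proof -
  interpret weighted_graph n E w es by fact
  have inj: "u = v" if uv: "u < n" "v < n" "\<forall>k<d. \<phi> u k = \<phi> v k" for u v
  proof (rule ccontr)
    assume "u \<noteq> v"
    then have "0 < real (graph_dist n E w u v)" using graph_dist_pos uv by simp
    moreover have "coord_dist d (\<phi> u) (\<phi> v) = 0" using uv(3) by (simp add: coord_dist_def)
    ultimately show False using dist uv(1,2) by fastforce
  qed
  have "\<alpha> \<ge> 0"
  proof (rule ccontr)
    assume "\<not> ?thesis"
    moreover have "0 < real (graph_dist n E w 0 1)" using graph_dist_pos assms(1) by simp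
    ultimately have "\<alpha> * real (graph_dist n E w 0 1) < 0" by (simp add: mult_neg_pos)
    moreover have "0 < n" "1 < n" using assms(1) by auto
    ultimately show False using dist \<open>0 < real (graph_dist n E w 0 1)\<close> by fastforce
  qed
  show "full_column_rank precond" by (rule precond_full_column_rank[OF inj])
  show "kappa (precond * incidence_mat n es * the (mat_inverse (weight_mat es w)))
      \<le> ennreal (4 * \<alpha> * (1 + real l) * real d)"
    unfolding add.commute[of 1 "real l"]
    by (rule kappa_precond_le[OF assms(3) _ _ \<open>\<alpha> \<ge> 0\<close> inj]) (use dist in blast)+
qed

end

section \<open>Degenerate inputs\<close>

text \<open>For \<open>n = 1\<close> the time bound is a constant, so not even \<open>d\<close> and \<open>\<Delta>\<close> may be read.\<close>

lemma single_vertex_runs: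
  "runs 2 main_prog (input_state 1 d \<Delta> \<phi>) 17 (\<lambda>s. arrs s ''size'' 0 = 1 \<and> arrs s ''lo'' 0 = 0 \<and>
     arrs s ''hi'' 0 = 0 \<and> arrs s ''num'' 0 = 1 \<and> arrs s ''den'' 0 = 1)" (is "runs _ _ ?s _ ?Q")
proof -
  have n: "regs ?s ''n'' = int 1" by (simp add: input_state_def)
  have "nval 2 (Num 0) s 0" "nval 2 (Num 1) s 1" "nval 2 (Num 2) s 2" for s
    by (intro nval_intros; simp)+
  note num = this
  have "runs 2 single_prog ?s (csize single_prog) ?Q"
    unfolding single_prog_def
    by (intro straight_Seq_direct straight_Store[OF num(1,2)]) (simp add: input_state_def)
  then have "runs 2 main_prog ?s (bsize (Less (Reg ''n'') (Num 2)) + 1 + csize single_prog) ?Q"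
    unfolding main_prog_def
    by (intro runs_Cond[OF bev_Less[OF nval_Reg[OF n] num(3)]]) auto
  \<comment> \<open>The 17 units are \<open>4 + 1\<close> for the test and 4 for each of three
    stores.\<close>
  then show ?thesis by (rule runs_mono) (auto simp: single_prog_def)
qed

lemma len_two: "len (int 2) \<le> 3"
  using len_le_iff[of 2 2] by simp

lemma single_vertex_out_col:
  assumes "arrs s ''size'' 0 = 1" "arrs s ''lo'' 0 = 0" "arrs s ''hi'' 0 = 0"
    "arrs s ''num'' 0 = 1" "arrs s ''den'' 0 = 1"
  shows "out_col s 0 = {((0, 0), 1)}"
  using assms by (simp add: out_col_def out_size_def)

text \<open>One vertex admits no edge, so the product has no columns and its operator norm is an
  empty supremum. An arbitrary \<open>x\<close> is allowed because \<alpha> may be negative here,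
  where \<open>ennreal\<close> yields 0.\<close>

lemma single_vertex_kappa:
  assumes "weighted_graph 1 E w es"
  shows "kappa (mat 1 1 (\<lambda>_. 1) * incidence_mat 1 es * the (mat_inverse (weight_mat es w))) \<le> x"
proof -
  interpret weighted_graph 1 E w es by fact
  have "E = {}" using edge_cases by (metis all_not_in_conv less_one)
  then have es: "es = []" using edges by simp
  have "the (mat_inverse (weight_mat es w)) = mat_diag 0 (\<lambda>j. 1 / real (w (es ! j)))"
    unfolding weight_mat_def es list.size by (subst mat_inverse_mat_diag) auto
  then have "dim_col (mat 1 1 (\<lambda>_. 1) * incidence_mat 1 es * the (mat_inverse (weight_mat es w))) = 0"
    by (simp add: mat_diag_def)
  moreover have "carrier_vec 0 - {0\<^sub>v 0 :: real vec} = {}" by auto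
  ultimately have "opnorm1 (mat 1 1 (\<lambda>_. 1) * incidence_mat 1 es * the (mat_inverse (weight_mat es w))) = 0"
    unfolding opnorm1_def by (simp only: image_empty Sup_empty bot_ennreal)
  then show ?thesis by (simp add: kappa_def)
qed

lemma single_vertex_compressed:
  assumes "out_col s 0 = {((0, 0), 1)}"
  shows "compressed_mat (out_col s) (mat 1 1 (\<lambda>_. 1))"
  using assms by (simp add: compressed_mat_def compressed_vec_def)

lemma single_vertex_full_column_rank: "full_column_rank (mat 1 1 (\<lambda>_. 1))"
proof (rule full_column_rankI[of _ 1 1])
  fix x :: "real vec" assume x: "x \<in> carrier_vec 1" "mat 1 1 (\<lambda>_. 1) *\<^sub>v x = 0\<^sub>v 1"
  have "(mat 1 1 (\<lambda>_. 1) *\<^sub>v x) $ 0 = x $ 0"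
    using mult_mat_vec_nth[of "mat 1 1 (\<lambda>_. 1)" 1 1 x 0] x(1) by simp
  then have "x $ 0 = 0" unfolding x(2) by simp
  then show "x = 0\<^sub>v 1" using x(1) by (intro eq_vecI) auto
qed simp

text \<open>Without coordinates all points coincide, so with two vertices no graph meets the
  distance bounds and the empty output is vacuously correct. Only the two tests cost time, and the
  length of \<open>n\<close> is at most \<open>n + 1\<close>.\<close>

lemma no_coordinates_exec:
  assumes "n \<ge> 2"
  shows "\<exists>t. exec main_prog (input_state n 0 \<Delta> \<phi>) t (input_state n 0 \<Delta> \<phi>) \<and> t \<le> 2 * n + 30"
proof -
  let ?s = "input_state n 0 \<Delta> \<phi>" and ?b = "Less (Reg ''n'') (Num 2)" and ?c = "Less (Reg ''d'') (Num 1)"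
  have s: "regs ?s ''n'' = int n" "regs ?s ''d'' = 0" by (simp_all add: input_state_def)
  have "exec main_prog ?s (bcost ?b ?s + 1 + (bcost ?c ?s + 1 + 1)) ?s"
    unfolding main_prog_def using assms s by (intro exec.CondFalse exec.CondTrue exec.Skip) auto
  moreover have "len (int n) \<le> Suc n"
  proof -
    have "int n < int (2 ^ n)" using less_exp[of n] by (simp only: of_nat_less_iff)
    then show ?thesis by (simp add: len_le_iff)
  qed
  moreover have "len 2 \<le> Suc 2" "len 1 \<le> Suc 1" "len 0 \<le> Suc 0"
    using len_le_iff[of 2 2] len_le_iff[of 1 1] len_le_iff[of 0 0] by simp_all
  ultimately show ?thesis using s by (intro exI conjI) auto
qed

theorem lemma4p15:
  shows "\<exists>(prog :: com) (p :: real poly) (C :: real).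
    \<forall>(n :: nat) (d :: nat) (l :: nat) (\<Delta> :: nat) (\<phi> :: nat \<Rightarrow> nat \<Rightarrow> nat) (L :: real).
      n \<ge> 1 \<longrightarrow> \<Delta> = 2 ^ l \<longrightarrow> L = 1 + log 2 (real \<Delta>) \<longrightarrow>
      (\<forall>v<n. \<forall>k<d. \<phi> v k \<in> {1..\<Delta>}) \<longrightarrow>
      (\<exists>(t :: nat) (s :: state).
         exec prog (input_state n d \<Delta> \<phi>) t s \<and>
         real t \<le> real n * poly p (real d * L * log 2 (real n)) \<and>
         (\<forall>i<n. real (card (out_col s i)) \<le> (real d + 1) * L) \<and>
         (\<forall>(E :: nat set set) (w :: nat set \<Rightarrow> nat) (es :: nat set list) (\<alpha> :: real).
            connected_weighted_graph n E w \<longrightarrow>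
            distinct es \<longrightarrow> set es = E \<longrightarrow>
            (\<forall>u<n. \<forall>v<n. real (graph_dist n E w u v) \<le> coord_dist d (\<phi> u) (\<phi> v) \<and>
                          coord_dist d (\<phi> u) (\<phi> v) \<le> \<alpha> * real (graph_dist n E w u v)) \<longrightarrow>
            (\<exists>(r :: nat) (P :: real mat).
               P \<in> carrier_mat r n \<and>
               compressed_mat (out_col s) P \<and>
               full_column_rank P \<and>
               kappa (P * incidence_mat n es * the (mat_inverse (weight_mat es w)))
                 \<le> ennreal (C * \<alpha> * L * real d))))"
proof (rule exI[of _ main_prog], rule exI[of _ "[:200:] + monom 210000 5"], rule exI[of _ 4], intro allI impI)
  let ?p = "[:200:] + monom 210000 5 :: real poly"
  \<comment> \<open>The constant 200 pays for the degenerate inputs, where the argument is 0; the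
    monomial comes from \<open>time_le\<close>.\<close>
  have poly: "poly ?p y = 200 + 210000 * y ^ 5" for y by (simp add: poly_monom)
  fix n d l \<Delta> :: nat and \<phi> :: "nat \<Rightarrow> nat \<Rightarrow> nat" and L :: real
  assume n: "n \<ge> 1" and \<Delta>: "\<Delta> = 2 ^ l" and L: "L = 1 + log 2 (real \<Delta>)"
    and range: "\<forall>v<n. \<forall>k<d. \<phi> v k \<in> {1..\<Delta>}"
  have L: "L = 1 + real l" using L \<Delta> by simp
  consider "n = 1" | "n \<ge> 2" "d = 0" | "n \<ge> 2" "d \<ge> 1" using n by linarith
  then show "\<exists>t s. exec main_prog (input_state n d \<Delta> \<phi>) t s \<and>
         real t \<le> real n * poly ?p (real d * L * log 2 (real n)) \<and>
         (\<forall>i<n. real (card (out_col s i)) \<le> (real d + 1) * L) \<and>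
         (\<forall>E w es \<alpha>. connected_weighted_graph n E w \<longrightarrow> distinct es \<longrightarrow> set es = E \<longrightarrow>
            (\<forall>u<n. \<forall>v<n. real (graph_dist n E w u v) \<le> coord_dist d (\<phi> u) (\<phi> v) \<and>
                          coord_dist d (\<phi> u) (\<phi> v) \<le> \<alpha> * real (graph_dist n E w u v)) \<longrightarrow>
            (\<exists>r P. P \<in> carrier_mat r n \<and> compressed_mat (out_col s) P \<and> full_column_rank P \<and>
               kappa (P * incidence_mat n es * the (mat_inverse (weight_mat es w)))
                 \<le> ennreal (4 * \<alpha> * L * real d)))"
  proof cases
    case 1
    obtain t s where ts: "exec main_prog (input_state 1 d \<Delta> \<phi>) t s" "t \<le> 17 * (len (int 2))\<^sup>2"
      "out_col s 0 = {((0, 0), 1)}"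
      using single_vertex_runs[of d \<Delta> \<phi>] single_vertex_out_col unfolding runs_def by blast
    have "(len (int 2))\<^sup>2 \<le> 3\<^sup>2" using len_two by (intro power_mono) auto
    \<comment> \<open>The time is at most \<open>17 * 9 = 153\<close>.\<close>
    then have "t \<le> 200" using ts(2) by simp
    then have time: "real t \<le> real n * poly ?p (real d * L * log 2 (real n))"
      unfolding poly using 1 by simp
    have card: "real (card (out_col s i)) \<le> (real d + 1) * L" if "i < n" for i
    proof -
      have "1 * 1 \<le> (real d + 1) * L" unfolding L by (intro mult_mono) auto
      then show ?thesis using that ts(3) 1 by simp
    qed
    have ex: "\<exists>r P. P \<in> carrier_mat r n \<and> compressed_mat (out_col s) P \<and> full_column_rank P \<and>
        kappa (P * incidence_mat n es * the (mat_inverse (weight_mat es w))) \<le> ennreal (4 * \<alpha> * L * real d)"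
      if "connected_weighted_graph n E w" "set es = E" for E w es \<alpha>
    proof -
      have "weighted_graph 1 E w es" using that unfolding 1 by unfold_locales
      then show ?thesis
        unfolding 1 using single_vertex_kappa single_vertex_compressed[OF ts(3)] single_vertex_full_column_rank
        by (intro exI[of _ 1] exI[of _ "mat 1 1 (\<lambda>_. 1)"] conjI) auto
    qed
    show ?thesis
    proof (rule exI[of _ t], rule exI[of _ s], intro conjI)
      show "exec main_prog (input_state n d \<Delta> \<phi>) t s" using ts(1) 1 by simp
      show "\<forall>i<n. real (card (out_col s i)) \<le> (real d + 1) * L" using card by blast
    qed (use time ex in blast)+
  next
    case 2
    let ?s = "input_state n d \<Delta> \<phi>"
    obtain t where t: "exec main_prog ?s t ?s" "t \<le> 2 * n + 30"
      using no_coordinates_exec[OF 2(1)] 2(2) by blast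
    have "out_col ?s i = {}" for i by (simp add: out_col_def out_size_def input_state_def)
    moreover have "real t \<le> real n * poly ?p (real d * L * log 2 (real n))"
    proof -
      have "2 * n + 30 \<le> 200 * n" using 2 by simp
      then have "real t \<le> real (200 * n)" using t(2) by linarith
      then show ?thesis unfolding poly using 2 by simp
    qed
    moreover have contradiction: False
      if "connected_weighted_graph n E w" "set es = E"
        "\<forall>u<n. \<forall>v<n. real (graph_dist n E w u v) \<le> coord_dist d (\<phi> u) (\<phi> v) \<and>
          coord_dist d (\<phi> u) (\<phi> v) \<le> \<alpha> * real (graph_dist n E w u v)" for E w es \<alpha>
    proof -
      interpret weighted_graph n E w es using that(1,2) by unfold_locales
      have "0 < n" "1 < n" using 2 by auto
      then have "graph_dist n E w 0 1 > 0" "real (graph_dist n E w 0 1) \<le> coord_dist d (\<phi> 0) (\<phi> 1)"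
        using graph_dist_pos that(3) by auto
      then show False using 2 by (simp add: coord_dist_def)
    qed
    moreover have "0 \<le> (real d + 1) * L" by (simp add: L)
    ultimately have "real t \<le> real n * poly ?p (real d * L * log 2 (real n))"
      "\<forall>i<n. real (card (out_col ?s i)) \<le> (real d + 1) * L" by simp_all
    then show ?thesis using t(1) contradiction by blast
  next
    case 3
    interpret vertex_grid n d l \<phi> using range \<Delta> by unfold_locales blast
    obtain t s where ts: "exec main_prog (input_state n d \<Delta> \<phi>) t s"
      "t \<le> 430 * (n * (Suc l * (Suc d * Suc d))) * (len (int bound))\<^sup>2" "loop_inv n 0 0 s"
      using main_prog_runs[OF 3] unfolding runs_def \<Delta> by blast
    have "real t \<le> real n * (210000 * (real d * L * log 2 (real n)) ^ 5)"
      using of_nat_mono[OF ts(2)] time_le[OF 3 refl] unfolding L by (rule order.trans)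
    also have "\<dots> \<le> real n * poly ?p (real d * L * log 2 (real n))"
      unfolding poly by (intro mult_left_mono) simp_all
    finally have "real t \<le> real n * poly ?p (real d * L * log 2 (real n))" .
    moreover have "real (card (out_col s i)) \<le> (real d + 1) * L" if "i < n" for i
    proof -
      have "real (card (out_col s i)) \<le> real ((d + 1) * (l + 1))"
        using card_out_col[OF ts(3) that] by (rule of_nat_mono)
      also have "\<dots> = (real d + 1) * L" by (simp add: L algebra_simps)
      finally show ?thesis .
    qed
    moreover have "\<exists>r P. P \<in> carrier_mat r n \<and> compressed_mat (out_col s) P \<and> full_column_rank P \<and>
        kappa (P * incidence_mat n es * the (mat_inverse (weight_mat es w))) \<le> ennreal (4 * \<alpha> * L * real d)"
      if g: "connected_weighted_graph n E w" "set es = E"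
        "\<forall>u<n. \<forall>v<n. real (graph_dist n E w u v) \<le> coord_dist d (\<phi> u) (\<phi> v) \<and>
          coord_dist d (\<phi> u) (\<phi> v) \<le> \<alpha> * real (graph_dist n E w u v)" for E w es \<alpha>
    proof -
      have "weighted_graph n E w es" using g(1,2) by unfold_locales
      from main_prog_correct[OF 3 this g(3)] show ?thesis
        unfolding L using precond_carrier compressed_precond[OF ts(3)] by blast
    qed
    ultimately show ?thesis using ts(1) by blast
  qed
qed

end
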